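(* Let $G=(V,E)$ be an LWF chain graph and let $p$ be a probability distribution over $V$ that satisfies the global Markov property with respect to $G$ and is faithful to $G$. Run the algorithm MbLWF (described in the context) on $V$ and $p$, and let $H^*$ be the graph it outputs at the end of its complex recovery phase (including the final step of taking the pattern). Then $G$ and $H^*$ have the same adjacencies and the same minimal complexes.
   Context: Graphs are finite and simple, each edge directed ($u\to v$) or undirected ($u-v$). A partially directed cycle is a sequence $v_1,\dots,v_n$, $n\ge3$, $v_n=v_1$, otherwise distinct, with $v_i-v_{i+1}$ or $v_i\to v_{i+1}$ for each $i<n$ and at least one edge $v_j\to v_{j+1}$. An LWF chain graph (CG) has no partially directed cycle. $pa(v)=\{u:u\to v\}$, $ch(v)=\{u:v\to u\}$, $ne(v)=\{u:u-v\}$. $bd(A)$ is the set of vertices in $V\setminus A$ that are parents or neighbors of some vertex of $A$; $bd(v)=pa(v)\cup ne(v)$. $A$ is ancestral if $bd(a)\subseteq A$ for all $a\in A$; $An(A)$ is the smallest ancestral set containing $A$. A minimal complex in a graph is an induced subgraph of the form $a\to v_1-\cdots-v_r\gets b$, $r\ge1$; $csp(a)$ is the set of $b$ for which such a minimal complex exists. The Markov blanket of $T$ in $G$ is $\mathbf{Mb}(T)=bd(T)\cup ch(T)\cup csp(T)$. The moral graph $G^m$ is the undirected graph on the same vertices with $\alpha,\beta$ adjacent iff they are adjacent in $G$ or $\alpha\in csp(\beta)$. For disjoint $A,B,S$, $S$ $c$-separates $A$ from $B$ in $G$ if $S$ separates $A$ from $B$ in $(G_{An(A\cup B\cup S)})^m$,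 where $G_A$ is the subgraph induced on $A$. Global Markov property: if $S$ $c$-separates $A$ from $B$ then $A\perp\!\!\!\perp_p B\mid S$ ($A,B,S$ disjoint). Faithfulness: for all distinct $X,Y\in V$ and $Z\subseteq V\setminus\{X,Y\}$, if $Z$ does not $c$-separate $X$ from $Y$ then $X\not\perp\!\!\!\perp_p Y\mid Z$. Two graphs on $V$ have the same adjacencies if they have the same pairs of vertices joined by an edge, ignoring type and direction. Algorithm MbLWF (all conditional independence queries are answered exactly according to $p$): Phase 1 (Markov blankets). For each $X\in V$ compute $\mathbf{Mb}(X)$ with a Markov blanket discovery algorithm that is sound for LWF chain graphs (so the correct Markov blankets of $G$ are obtained). If $X\notin\mathbf{Mb}(Y)$ and $Y\notin\mathbf{Mb}(X)$, set $S_{XY}=S_{YX}$ to the smaller of $\mathbf{Mb}(X)$ and $\mathbf{Mb}(Y)$ (ties broken arbitrarily). Phase 2 (skeleton recovery). Let $H$ be the undirected graph on $V$ with $X-Y$ iff $Y\in\mathbf{Mb}(X)$ and $X\in\mathbf{Mb}(Y)$; $ad_H(x)$ is the current set of vertices adjacent to $x$ in $H$. For $i=0,1,\dots,|V|-2$: while possible, select an ordered pair $(u,v)$ (not yet treated for this $i$) with $u\in ad_H(v)$ and $|ad_H(u)\setminus\{v\}|\ge i$; if there is $S\subseteq ad_H(u)\setminus\{v\}$ with $|S|=i$ and $u\perp\!\!\!\perp_p v\mid S$, set $S_{uv}=S_{vu}=S$ and remove the edge $u-v$ from $H$. Phase 3 (complex recovery). Initialize $H^*=H$. For each pair $u,v$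 of distinct vertices not adjacent in $H$ (each of the two taking the role of $u$), and for each edge $u-w$ currently undirected in $H^*$: if $u\not\perp\!\!\!\perp_p v\mid S_{uv}\cup\{w\}$, orient $u-w$ as $u\to w$ in $H^*$. Finally take the pattern of $H^*$: for each pair of arrows $u_1\to w_1$, $u_2\to w_2$ of $H^*$ with $u_1\ne u_2$, if there is an undirected path in $H^*$ from $w_1$ to $w_2$ (possibly of length $0$, when $w_1=w_2$) none of whose intermediate vertices is adjacent to $u_1$ or $u_2$, label both arrows; after all pairs have been examined, replace every unlabeled arrow of $H^*$ by an undirected edge. *)

theory Defs
  imports "HOL-Probability.Probability"
begin

section \<open>Graphs with directed and undirected edges\<close>

text \<open>
  The pair set \<open>edges\<close> encodes both kinds of edges, following the usual convention for chain graphs: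
  \<open>u \<rightarrow> v\<close> iff it contains \<open>(u, v)\<close> but not \<open>(v, u)\<close>, and \<open>u - v\<close> iff it contains both. Hence there is at
  most one edge between two vertices, and an undirected graph is one whose pair set is symmetric.
\<close>

record 'v mgraph =
  verts :: "'v set"
  edges :: "('v \<times> 'v) set"

definition is_graph :: "'v mgraph \<Rightarrow> bool" where
  "is_graph G \<longleftrightarrow> finite (verts G) \<and> edges G \<subseteq> verts G \<times> verts G \<and> irrefl (edges G)"

definition arrow :: "'v mgraph \<Rightarrow> 'v \<Rightarrow> 'v \<Rightarrow> bool" where
  "arrow G u v \<longleftrightarrow> (u, v) \<in> edges G \<and> (v, u) \<notin> edges G"

definition line :: "'v mgraph \<Rightarrow> 'v \<Rightarrow> 'v \<Rightarrow> bool" where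
  "line G u v \<longleftrightarrow> (u, v) \<in> edges G \<and> (v, u) \<in> edges G"

definition adjacent :: "'v mgraph \<Rightarrow> 'v \<Rightarrow> 'v \<Rightarrow> bool" where
  "adjacent G u v \<longleftrightarrow> arrow G u v \<or> arrow G v u \<or> line G u v"

definition same_adjacencies :: "'v mgraph \<Rightarrow> 'v mgraph \<Rightarrow> bool" where
  "same_adjacencies G H \<longleftrightarrow> verts G = verts H \<and> (\<forall>u v. adjacent G u v \<longleftrightarrow> adjacent H u v)"

definition partially_directed_cycle :: "'v mgraph \<Rightarrow> 'v list \<Rightarrow> bool" where
  "partially_directed_cycle G vs \<longleftrightarrow>
     length vs \<ge> 3 \<and> last vs = hd vs \<and> distinct (butlast vs) \<and>
     successively (\<lambda>u v. line G u v \<or> arrow G u v) vs \<and>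
     (\<exists>j. Suc j < length vs \<and> arrow G (vs ! j) (vs ! Suc j))"

definition lwf_chain_graph :: "'v mgraph \<Rightarrow> bool" where
  "lwf_chain_graph G \<longleftrightarrow> is_graph G \<and> (\<nexists>vs. partially_directed_cycle G vs)"

definition pa :: "'v mgraph \<Rightarrow> 'v \<Rightarrow> 'v set" where
  "pa G v = {u. arrow G u v}"

definition ch :: "'v mgraph \<Rightarrow> 'v \<Rightarrow> 'v set" where
  "ch G v = {u. arrow G v u}"

definition ne :: "'v mgraph \<Rightarrow> 'v \<Rightarrow> 'v set" where
  "ne G v = {u. line G u v}"

definition bd :: "'v mgraph \<Rightarrow> 'v set \<Rightarrow> 'v set" where
  "bd G A = (\<Union>a\<in>A. pa G a \<union> ne G a) - A"

definition ancestral :: "'v mgraph \<Rightarrow> 'v set \<Rightarrow> bool" where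
  "ancestral G A \<longleftrightarrow> A \<subseteq> verts G \<and> (\<forall>a\<in>A. bd G {a} \<subseteq> A)"

definition An :: "'v mgraph \<Rightarrow> 'v set \<Rightarrow> 'v set" where
  "An G A = \<Inter>{B. ancestral G B \<and> A \<subseteq> B}"

definition induced :: "'v mgraph \<Rightarrow> 'v set \<Rightarrow> 'v mgraph" where
  "induced G A = \<lparr>verts = A, edges = edges G \<inter> A \<times> A\<rparr>"

text \<open>The graph \<open>a \<rightarrow> v\<^sub>1 - \<dots> - v\<^sub>r \<leftarrow> b\<close>, where \<open>vs\<close> lists \<open>v\<^sub>1, \<dots>, v\<^sub>r\<close>.\<close>

definition complex_graph :: "'v \<Rightarrow> 'v list \<Rightarrow> 'v \<Rightarrow> 'v mgraph" where
  "complex_graph a vs b =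
     \<lparr>verts = {a, b} \<union> set vs,
      edges = {(a, hd vs), (b, last vs)} \<union>
        {(vs ! i, vs ! Suc i) |i. Suc i < length vs} \<union>
        {(vs ! Suc i, vs ! i) |i. Suc i < length vs}\<rparr>"

definition is_minimal_complex :: "'v mgraph \<Rightarrow> 'v \<Rightarrow> 'v list \<Rightarrow> 'v \<Rightarrow> bool" where
  "is_minimal_complex G a vs b \<longleftrightarrow>
     vs \<noteq> [] \<and> distinct (a # vs @ [b]) \<and> {a, b} \<union> set vs \<subseteq> verts G \<and>
     induced G ({a, b} \<union> set vs) = complex_graph a vs b"

definition minimal_complexes :: "'v mgraph \<Rightarrow> 'v mgraph set" where
  "minimal_complexes G = {complex_graph a vs b |a vs b. is_minimal_complex G a vs b}"

definition csp :: "'v mgraph \<Rightarrow> 'v \<Rightarrow> 'v set" where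
  "csp G a = {b. \<exists>vs. is_minimal_complex G a vs b}"

definition Mb :: "'v mgraph \<Rightarrow> 'v \<Rightarrow> 'v set" where
  "Mb G t = bd G {t} \<union> ch G t \<union> csp G t"

definition moral :: "'v mgraph \<Rightarrow> 'v mgraph" where
  "moral G =
     \<lparr>verts = verts G,
      edges = {(x, y). x \<in> verts G \<and> y \<in> verts G \<and> (adjacent G x y \<or> x \<in> csp G y)}\<rparr>"

definition undirected_path :: "'v mgraph \<Rightarrow> 'v list \<Rightarrow> bool" where
  "undirected_path G xs \<longleftrightarrow>
     xs \<noteq> [] \<and> distinct xs \<and> set xs \<subseteq> verts G \<and> successively (line G) xs"

definition separates :: "'v mgraph \<Rightarrow> 'v set \<Rightarrow> 'v set \<Rightarrow> 'v set \<Rightarrow> bool" where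
  "separates U S A B \<longleftrightarrow>
     (\<forall>xs. undirected_path U xs \<and> hd xs \<in> A \<and> last xs \<in> B \<longrightarrow> set xs \<inter> S \<noteq> {})"

definition c_separates :: "'v mgraph \<Rightarrow> 'v set \<Rightarrow> 'v set \<Rightarrow> 'v set \<Rightarrow> bool" where
  "c_separates G S A B \<longleftrightarrow> separates (moral (induced G (An G (A \<union> B \<union> S)))) S A B"


section \<open>Conditional independence\<close>

text \<open>
  A distribution over \<open>V\<close> is a probability measure on the product of the measurable spaces \<open>N v\<close>,
  \<open>v \<in> V\<close>; the variable belonging to \<open>v\<close> is the coordinate map at \<open>v\<close>. The spaces \<open>N v\<close> are arbitrary.
\<close>

definition distribution_over :: "'v set \<Rightarrow> ('v \<Rightarrow> 'a measure) \<Rightarrow> ('v \<Rightarrow> 'a) measure \<Rightarrow> bool" where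
  "distribution_over V N p \<longleftrightarrow> prob_space p \<and> sets p = sets (PiM V N)"

text \<open>The \<open>\<sigma>\<close>-algebra generated by the variables in \<open>A\<close>.\<close>

definition coord_algebra ::
    "('v \<Rightarrow> 'a measure) \<Rightarrow> ('v \<Rightarrow> 'a) measure \<Rightarrow> 'v set \<Rightarrow> ('v \<Rightarrow> 'a) measure" where
  "coord_algebra N p A = vimage_algebra (space p) (\<lambda>x. restrict x A) (PiM A N)"

definition cond_indep ::
    "('v \<Rightarrow> 'a measure) \<Rightarrow> ('v \<Rightarrow> 'a) measure \<Rightarrow> 'v set \<Rightarrow> 'v set \<Rightarrow> 'v set \<Rightarrow> bool" where
  "cond_indep N p A B S \<longleftrightarrow>
     (\<forall>E\<in>sets (coord_algebra N p A). \<forall>F\<in>sets (coord_algebra N p B).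
        AE x in p. real_cond_exp p (coord_algebra N p S) (indicator (E \<inter> F)) x =
          real_cond_exp p (coord_algebra N p S) (indicator E) x *
          real_cond_exp p (coord_algebra N p S) (indicator F) x)"

text \<open>\<^const>\<open>real_cond_exp\<close> takes a default value unless it is given a subalgebra; here it always is.\<close>

lemma subalgebra_coord_algebra:
  assumes "distribution_over V N p" and "S \<subseteq> V"
  shows "subalgebra p (coord_algebra N p S)"
proof -
  have sets_p: "sets p = sets (PiM V N)"
    using assms(1) by (simp add: distribution_over_def)
  have "(\<lambda>x. restrict x S) \<in> measurable p (PiM S N)"
    unfolding measurable_cong_sets[OF sets_p refl] using assms(2) by (rule measurable_restrict_subset)
  then show ?thesis
    by (auto simp: subalgebra_def coord_algebra_def sets_vimage_algebra2 measurable_def)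
qed

definition global_markov ::
    "'v mgraph \<Rightarrow> ('v \<Rightarrow> 'a measure) \<Rightarrow> ('v \<Rightarrow> 'a) measure \<Rightarrow> bool" where
  "global_markov G N p \<longleftrightarrow>
     (\<forall>A B S. A \<subseteq> verts G \<and> B \<subseteq> verts G \<and> S \<subseteq> verts G \<and>
        A \<inter> B = {} \<and> A \<inter> S = {} \<and> B \<inter> S = {} \<and> c_separates G S A B \<longrightarrow> cond_indep N p A B S)"

definition faithful ::
    "'v mgraph \<Rightarrow> ('v \<Rightarrow> 'a measure) \<Rightarrow> ('v \<Rightarrow> 'a) measure \<Rightarrow> bool" where
  "faithful G N p \<longleftrightarrow>
     (\<forall>x\<in>verts G. \<forall>y\<in>verts G. \<forall>Z \<subseteq> verts G - {x, y}.
        x \<noteq> y \<and> \<not> c_separates G Z {x} {y} \<longrightarrow> \<not> cond_indep N p {x} {y} Z)"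


section \<open>The algorithm\<close>

text \<open>
  \<open>ind A B S\<close> answers conditional independence queries, \<open>mb\<close> is the output of the Markov blanket
  discovery, and \<open>sep (u, v)\<close> holds the separating set \<open>S\<^sub>u\<^sub>v\<close>; entries of \<open>sep\<close> that
  have not been assigned are arbitrary. The algorithm is nondeterministic, so its phases are relations.
\<close>

definition ad :: "'v mgraph \<Rightarrow> 'v \<Rightarrow> 'v set" where
  "ad H x = {y. adjacent H x y}"

definition blanket_separators ::
    "'v set \<Rightarrow> ('v \<Rightarrow> 'v set) \<Rightarrow> ('v \<times> 'v \<Rightarrow> 'v set) \<Rightarrow> bool" where
  "blanket_separators V mb sep \<longleftrightarrow>
     (\<forall>x\<in>V. \<forall>y\<in>V. x \<noteq> y \<and> x \<notin> mb y \<and> y \<notin> mb x \<longrightarrow>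
        sep (x, y) = sep (y, x) \<and>
        (sep (x, y) = mb x \<and> card (mb x) \<le> card (mb y) \<or>
         sep (x, y) = mb y \<and> card (mb y) \<le> card (mb x)))"

definition blanket_graph :: "'v set \<Rightarrow> ('v \<Rightarrow> 'v set) \<Rightarrow> 'v mgraph" where
  "blanket_graph V mb =
     \<lparr>verts = V, edges = {(x, y). x \<in> V \<and> y \<in> V \<and> x \<noteq> y \<and> y \<in> mb x \<and> x \<in> mb y}\<rparr>"

definition delete_edge :: "'v \<Rightarrow> 'v \<Rightarrow> 'v mgraph \<Rightarrow> 'v mgraph" where
  "delete_edge u v H = H\<lparr>edges := edges H - {(u, v), (v, u)}\<rparr>"

text \<open>The set \<open>T\<close> collects the ordered pairs already treated for the current \<open>i\<close>.\<close>

definition selectable :: "nat \<Rightarrow> 'v mgraph \<Rightarrow> ('v \<times> 'v) set \<Rightarrow> 'v \<Rightarrow> 'v \<Rightarrow> bool" where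
  "selectable i H T u v \<longleftrightarrow> (u, v) \<notin> T \<and> u \<in> ad H v \<and> card (ad H u - {v}) \<ge> i"

type_synonym 'v skel_state = "'v mgraph \<times> ('v \<times> 'v \<Rightarrow> 'v set) \<times> ('v \<times> 'v) set"

inductive skel_step ::
    "('v set \<Rightarrow> 'v set \<Rightarrow> 'v set \<Rightarrow> bool) \<Rightarrow> nat \<Rightarrow> 'v skel_state \<Rightarrow> 'v skel_state \<Rightarrow> bool"
  for ind i where
  remove: "\<lbrakk>selectable i H T u v; S \<subseteq> ad H u - {v}; card S = i; ind {u} {v} S\<rbrakk> \<Longrightarrow>
    skel_step ind i (H, sep, T)
      (delete_edge u v H, sep((u, v) := S, (v, u) := S), insert (u, v) T)"
| keep: "\<lbrakk>selectable i H T u v; \<nexists>S. S \<subseteq> ad H u - {v} \<and> card S = i \<and> ind {u} {v} S\<rbrakk> \<Longrightarrow>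
    skel_step ind i (H, sep, T) (H, sep, insert (u, v) T)"

text \<open>\<open>skel_rounds ind n H sep H' sep'\<close>: the rounds \<open>i = 0, \<dots>, n - 1\<close> can lead from \<open>H, sep\<close> to \<open>H', sep'\<close>.\<close>

inductive skel_rounds ::
    "('v set \<Rightarrow> 'v set \<Rightarrow> 'v set \<Rightarrow> bool) \<Rightarrow> nat \<Rightarrow> 'v mgraph \<Rightarrow> ('v \<times> 'v \<Rightarrow> 'v set) \<Rightarrow>
     'v mgraph \<Rightarrow> ('v \<times> 'v \<Rightarrow> 'v set) \<Rightarrow> bool"
  for ind where
  start: "skel_rounds ind 0 H sep H sep"
| round: "\<lbrakk>skel_rounds ind i H sep H' sep';
     (skel_step ind i)\<^sup>*\<^sup>* (H', sep', {}) (H'', sep'', T);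
     \<nexists>u v. selectable i H'' T u v\<rbrakk> \<Longrightarrow>
   skel_rounds ind (Suc i) H sep H'' sep''"

definition orient :: "'v \<Rightarrow> 'v \<Rightarrow> 'v mgraph \<Rightarrow> 'v mgraph" where
  "orient u w H = H\<lparr>edges := edges H - {(w, u)}\<rparr>"

definition orient_step ::
    "('v set \<Rightarrow> 'v set \<Rightarrow> 'v set \<Rightarrow> bool) \<Rightarrow> ('v \<times> 'v \<Rightarrow> 'v set) \<Rightarrow>
     'v \<times> 'v \<times> 'v \<Rightarrow> 'v mgraph \<Rightarrow> 'v mgraph" where
  "orient_step ind sep = (\<lambda>(u, v, w) H.
     if line H u w \<and> \<not> ind {u} {v} (sep (u, v) \<union> {w}) then orient u w H else H)"

text \<open>Every order of treating the pairs \<open>(u, v)\<close> together with the edges \<open>u - w\<close> is allowed.\<close>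

definition orientation_phase ::
    "('v set \<Rightarrow> 'v set \<Rightarrow> 'v set \<Rightarrow> bool) \<Rightarrow> 'v mgraph \<Rightarrow> ('v \<times> 'v \<Rightarrow> 'v set) \<Rightarrow> 'v mgraph \<Rightarrow> bool" where
  "orientation_phase ind H sep H' \<longleftrightarrow>
     (\<exists>ts. distinct ts \<and>
        set ts = {(u, v, w). u \<in> verts H \<and> v \<in> verts H \<and> u \<noteq> v \<and> \<not> adjacent H u v \<and> line H u w} \<and>
        H' = fold (orient_step ind sep) ts H)"

definition label_pair :: "'v mgraph \<Rightarrow> 'v \<times> 'v \<Rightarrow> 'v \<times> 'v \<Rightarrow> bool" where
  "label_pair H = (\<lambda>(u1, w1) (u2, w2).
     arrow H u1 w1 \<and> arrow H u2 w2 \<and> u1 \<noteq> u2 \<and>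
     (\<exists>xs. undirected_path H xs \<and> hd xs = w1 \<and> last xs = w2 \<and>
        (\<forall>x\<in>set (butlast (tl xs)). \<not> adjacent H x u1 \<and> \<not> adjacent H x u2)))"

definition labeled :: "'v mgraph \<Rightarrow> ('v \<times> 'v) set" where
  "labeled H = (\<Union>{{e, f} |e f. label_pair H e f})"

definition pattern :: "'v mgraph \<Rightarrow> 'v mgraph" where
  "pattern H = H\<lparr>edges := edges H \<union> {(w, u). arrow H u w \<and> (u, w) \<notin> labeled H}\<rparr>"

text \<open>
  \<open>MbLWF V mb ind H'\<close>: some run of the algorithm outputs \<open>H'\<close>. The rounds are \<open>i = 0, \<dots>, |V| - 2\<close>.
\<close>

definition MbLWF ::
    "'v set \<Rightarrow> ('v \<Rightarrow> 'v set) \<Rightarrow> ('v set \<Rightarrow> 'v set \<Rightarrow> 'v set \<Rightarrow> bool) \<Rightarrow> 'v mgraph \<Rightarrow> bool" where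
  "MbLWF V mb ind Hstar \<longleftrightarrow>
     (\<exists>sep0 H sep H'.
        blanket_separators V mb sep0 \<and>
        skel_rounds ind (card V - 1) (blanket_graph V mb) sep0 H sep \<and>
        orientation_phase ind H sep H' \<and>
        Hstar = pattern H')"

end

(*
  By the global Markov property and faithfulness, independence queries on two vertices decide
  c-separation. The boundary of u separates u from every nonadjacent vertex that is not a proper
  descendant, so the skeleton phase removes exactly the edges between nonadjacent vertices. If a set S
  separates u from v but S with w does not, then w is not an ancestor of u, v or S; hence every
  orientation u -> w made by the algorithm is an arrow of G. Conversely, if u -> w starts a minimal
  complex ending in v, adding w to any separating set puts the whole complex into the ancestral set, so
  u -> w is oriented and then labeled. A graph obtained from G by turning into lines only arrows that
  bound no minimal complex has the same minimal complexes.
*)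
theory Submission
  imports Defs
begin

section \<open>Paths and ancestral sets\<close>

lemma arrow_or_line: "arrow G u v \<or> line G u v \<longleftrightarrow> (u, v) \<in> edges G"
  by (auto simp: arrow_def line_def)

lemma adjacent_iff: "adjacent G u v \<longleftrightarrow> (u, v) \<in> edges G \<or> (v, u) \<in> edges G"
  by (auto simp: adjacent_def arrow_def line_def)

text \<open>Irreflexivity makes the subtraction of \<open>{u}\<close> in \<open>bd\<close> harmless;
  parents and neighbours together are all sources of pairs into \<open>u\<close>.\<close>

lemma bd_singleton: "is_graph G \<Longrightarrow> bd G {u} = {w. (w, u) \<in> edges G}"
  by (auto simp: bd_def pa_def ne_def arrow_def line_def is_graph_def irrefl_def)

lemma is_graph_lwf: "lwf_chain_graph G \<Longrightarrow> is_graph G"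
  by (simp add: lwf_chain_graph_def)

text \<open>The set on the right is ancestral, and every ancestral superset of \<open>A\<close>
  absorbs it by induction along the walk. For \<open>A\<close> not inside \<open>verts G\<close> the
  intersection in \<open>An\<close> would range over the empty family.\<close>

lemma An_eq:
  assumes "is_graph G" "A \<subseteq> verts G"
  shows "An G A = {x. \<exists>a\<in>A. (x, a) \<in> (edges G)\<^sup>*}"
proof
  let ?R = "{x. \<exists>a\<in>A. (x, a) \<in> (edges G)\<^sup>*}"
  have "?R \<subseteq> verts G"
    using assms by (auto simp: is_graph_def elim: converse_rtranclE)
  then have "ancestral G ?R"
    using assms(1) by (auto simp: ancestral_def bd_singleton intro: converse_rtrancl_into_rtrancl)
  then show "An G A \<subseteq> ?R"
    by (auto simp: An_def)
  show "?R \<subseteq> An G A"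
  proof
    fix x assume "x \<in> ?R"
    then obtain a where a: "a \<in> A" "(x, a) \<in> (edges G)\<^sup>*" by auto
    have "x \<in> B" if B: "ancestral G B" "A \<subseteq> B" for B
      using a(2)
    proof (induction rule: converse_rtrancl_induct)
      case base
      then show ?case using a(1) B(2) by auto
    next
      case (step y z)
      then show ?case using B(1) assms(1) by (auto simp: ancestral_def bd_singleton)
    qed
    then show "x \<in> An G A" by (auto simp: An_def)
  qed
qed

lemma An_subset_verts: "\<lbrakk>is_graph G; A \<subseteq> verts G\<rbrakk> \<Longrightarrow> An G A \<subseteq> verts G"
  by (auto simp: An_eq is_graph_def elim: converse_rtranclE)

text \<open>Vertices are prepended one at a time; a vertex that already lies on the path cuts it
  down to the suffix starting there.\<close>

lemma rtrancl_distinct_path: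
  assumes "(x, y) \<in> r\<^sup>*"
  shows "\<exists>xs. xs \<noteq> [] \<and> hd xs = x \<and> last xs = y \<and> distinct xs \<and>
    successively (\<lambda>u v. (u, v) \<in> r) xs"
  using assms
proof (induction rule: converse_rtrancl_induct)
  case base
  show ?case by (rule exI[of _ "[y]"]) auto
next
  case (step x z)
  then obtain xs where xs: "xs \<noteq> []" "hd xs = z" "last xs = y" "distinct xs"
    "successively (\<lambda>u v. (u, v) \<in> r) xs"
    by blast
  show ?case
  proof (cases "x \<in> set xs")
    case True
    then obtain ys zs where "xs = ys @ x # zs"
      by (meson split_list)
    then show ?thesis
      using xs by (intro exI[of _ "x # zs"]) (auto simp: successively_append_iff)
  next
    case False
    then show ?thesis
      using xs step.hyps by (intro exI[of _ "x # xs"]) (auto simp: successively_Cons)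
  qed
qed

text \<open>A repetition-free path back from \<open>w\<close> to \<open>u\<close> becomes a
  partially directed cycle once \<open>u\<close> is put in front of it. The absence of such cycles
  enters the proof here.\<close>

lemma arrow_not_rtrancl:
  assumes "lwf_chain_graph G" "arrow G u w"
  shows "(w, u) \<notin> (edges G)\<^sup>*"
proof
  assume "(w, u) \<in> (edges G)\<^sup>*"
  then obtain xs where xs: "xs \<noteq> []" "hd xs = w" "last xs = u" "distinct xs"
    "successively (\<lambda>u v. (u, v) \<in> edges G) xs"
    using rtrancl_distinct_path by metis
  have "u \<noteq> w"
    using assms by (auto simp: arrow_def)
  then have "length xs \<ge> 2"
    using xs by (cases xs; cases "tl xs") auto
  moreover have "distinct (u # butlast xs)"
    using xs by (metis append_butlast_last_id distinct.simps(2) distinct_append distinct_butlast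
        not_distinct_conv_prefix)
  moreover have "arrow G ((u # xs) ! 0) ((u # xs) ! Suc 0)"
    using xs assms by (simp add: hd_conv_nth)
  ultimately have "partially_directed_cycle G (u # xs)"
    using xs assms(2) arrow_or_line[of G u w] unfolding partially_directed_cycle_def
    by (auto simp: successively_Cons disj_commute[of "line _ _ _"] arrow_or_line intro!: exI[of _ 0])
  then show False
    using assms(1) by (auto simp: lwf_chain_graph_def)
qed

section \<open>Minimal complexes by position\<close>

text \<open>The edges of \<open>w\<^sub>0 \<rightarrow> w\<^sub>1 - \<dots> - w\<^sub>n\<^sub>-\<^sub>2 \<leftarrow> w\<^sub>n\<^sub>-\<^sub>1\<close>, read off the indices.\<close>

definition complex_index :: "nat \<Rightarrow> nat \<Rightarrow> nat \<Rightarrow> bool" where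
  "complex_index n i j \<longleftrightarrow> (j = Suc i \<and> Suc j < n) \<or> (i = Suc j \<and> 0 < j)"

text \<open>Ends and inner vertices share one list, so that reversing a complex and cutting a window
  out of a list, both needed below, are plain list operations.\<close>

definition complex_seq :: "'v mgraph \<Rightarrow> 'v list \<Rightarrow> bool" where
  "complex_seq G ws \<longleftrightarrow> length ws \<ge> 3 \<and> distinct ws \<and> set ws \<subseteq> verts G \<and>
     (\<forall>i<length ws. \<forall>j<length ws. (ws ! i, ws ! j) \<in> edges G \<longleftrightarrow> complex_index (length ws) i j)"

lemma complex_graph_edges:
  fixes a b :: 'v
  assumes "vs \<noteq> []"
  defines "ws \<equiv> a # vs @ [b]"
  shows "edges (complex_graph a vs b) =
    {(ws ! i, ws ! j) |i j. i < length ws \<and> j < length ws \<and> complex_index (length ws) i j}"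
    (is "_ = ?R")
proof
  have vs: "vs ! i = ws ! Suc i" if "i < length vs" for i
    using that by (simp add: ws_def nth_append)
  have len: "length ws = length vs + 2"
    by (simp add: ws_def)
  have ends: "a = ws ! 0" "hd vs = ws ! 1" "b = ws ! Suc (length vs)" "last vs = ws ! length vs"
    using assms(1) by (auto simp: ws_def nth_append hd_conv_nth last_conv_nth)
  have "0 < length vs"
    using assms(1) by simp
  show "edges (complex_graph a vs b) \<subseteq> ?R"
  proof (rule subrelI)
    fix x y assume "(x, y) \<in> edges (complex_graph a vs b)"
    then consider "x = a" "y = hd vs" | "x = b" "y = last vs"
      | i where "Suc i < length vs" "x = vs ! i" "y = vs ! Suc i"
      | i where "Suc i < length vs" "y = vs ! i" "x = vs ! Suc i"
      by (auto simp: complex_graph_def)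
    then show "(x, y) \<in> ?R"
    proof cases
      case 1
      then have "x = ws ! 0 \<and> y = ws ! 1 \<and> complex_index (length ws) 0 1"
        using \<open>0 < length vs\<close> by (simp add: ends len complex_index_def)
      then show ?thesis using len by force
    next
      case 2
      then have "x = ws ! Suc (length vs) \<and> y = ws ! length vs \<and>
          complex_index (length ws) (Suc (length vs)) (length vs)"
        using \<open>0 < length vs\<close> by (simp add: ends(3,4) len complex_index_def)
      then show ?thesis using len by force
    next
      case 3
      then have "x = ws ! Suc i \<and> y = ws ! Suc (Suc i) \<and>
          complex_index (length ws) (Suc i) (Suc (Suc i))"
        by (simp add: vs len complex_index_def)
      moreover have "Suc i < length ws" "Suc (Suc i) < length ws"
        using 3 len by auto
      ultimately show ?thesis by blast
    next
      case 4
      then have "x = ws ! Suc (Suc i) \<and> y = ws ! Suc i \<and>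
          complex_index (length ws) (Suc (Suc i)) (Suc i)"
        by (simp add: vs len complex_index_def)
      moreover have "Suc i < length ws" "Suc (Suc i) < length ws"
        using 4 len by auto
      ultimately show ?thesis by blast
    qed
  qed
  show "?R \<subseteq> edges (complex_graph a vs b)"
  proof (rule subrelI)
    fix x y assume "(x, y) \<in> ?R"
    then obtain i j where ij: "x = ws ! i" "y = ws ! j" "i < length ws" "j < length ws"
      "complex_index (length ws) i j"
      by auto
    \<comment> \<open>The bound \<open>j \<le> length vs\<close> in \<open>right\<close> keeps
      \<open>b\<close> from being a target.\<close>
    then consider (right) "j = Suc i" "j \<le> length vs" | (left) "i = Suc j" "0 < j" "j \<le> length vs"
      by (auto simp: complex_index_def len)
    then show "(x, y) \<in> edges (complex_graph a vs b)"
    proof cases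
      case right
      show ?thesis
      proof (cases i)
        case 0
        then have "x = a" "y = hd vs" by (simp_all add: ij(1,2) right ends(1,2))
        then show ?thesis by (simp add: complex_graph_def)
      next
        case (Suc k)
        then have "x = vs ! k" "y = vs ! Suc k" "Suc k < length vs"
          using right vs[of k] vs[of "Suc k"] by (simp_all add: ij(1,2))
        then show ?thesis by (auto simp: complex_graph_def)
      qed
    next
      case left
      then obtain k where k: "j = Suc k" by (cases j) auto
      show ?thesis
      proof (cases "j = length vs")
        case True
        then have "x = b" "y = last vs" by (simp_all add: ij(1,2) left(1) ends(3,4))
        then show ?thesis by (simp add: complex_graph_def)
      next
        case False
        then have "y = vs ! k" "x = vs ! Suc k" "Suc k < length vs"
          using left vs[of k] vs[of "Suc k"] k by (simp_all add: ij(1,2))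
        then show ?thesis by (auto simp: complex_graph_def)
      qed
    qed
  qed
qed

text \<open>Distinctness lets a pair of vertices determine its pair of indices, so an equation
  between edge sets can be tested index by index.\<close>

lemma Int_Times_eq_nth_pairs_iff:
  assumes "distinct ws"
  shows "E \<inter> set ws \<times> set ws = {(ws ! i, ws ! j) |i j. i < length ws \<and> j < length ws \<and> P i j} \<longleftrightarrow>
    (\<forall>i<length ws. \<forall>j<length ws. (ws ! i, ws ! j) \<in> E \<longleftrightarrow> P i j)" (is "?L = ?C \<longleftrightarrow> ?R")
proof
  assume eq: "?L = ?C"
  show ?R
  proof (intro allI impI)
    fix i j assume ij: "i < length ws" "j < length ws"
    have "(ws ! i, ws ! j) \<in> E \<longleftrightarrow> (ws ! i, ws ! j) \<in> ?L"
      using ij by simp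
    also have "\<dots> \<longleftrightarrow> (ws ! i, ws ! j) \<in> ?C"
      by (simp only: eq)
    also have "\<dots> \<longleftrightarrow> P i j"
      using ij nth_eq_iff_index_eq[OF assms] by auto
    finally show "(ws ! i, ws ! j) \<in> E \<longleftrightarrow> P i j" .
  qed
next
  assume R: ?R
  show "?L = ?C"
  proof (rule set_eqI, rule iffI)
    fix e assume "e \<in> ?L"
    then obtain x y where e: "e = (x, y)" "(x, y) \<in> E" "x \<in> set ws" "y \<in> set ws"
      by blast
    then obtain i j where "i < length ws" "ws ! i = x" "j < length ws" "ws ! j = y"
      by (metis in_set_conv_nth)
    then show "e \<in> ?C" using R e by blast
  next
    fix e assume "e \<in> ?C"
    then show "e \<in> ?L" using R by auto
  qed
qed

text \<open>The vertex sets of the two graphs agree, so only their edge sets have to be compared. An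
  empty \<open>vs\<close> is excluded on the right by the length bound.\<close>

lemma is_minimal_complex_iff_seq:
  "is_minimal_complex G a vs b \<longleftrightarrow> complex_seq G (a # vs @ [b])"
proof (cases "vs = []")
  case True
  then show ?thesis by (simp add: is_minimal_complex_def complex_seq_def)
next
  case False
  define ws where "ws = a # vs @ [b]"
  have K: "{a, b} \<union> set vs = set ws" and len: "length ws \<ge> 3"
    using False by (auto simp: ws_def Suc_le_eq)
  have "induced G (set ws) = complex_graph a vs b \<longleftrightarrow>
      edges G \<inter> set ws \<times> set ws = edges (complex_graph a vs b)"
    unfolding induced_def complex_graph_def K by simp
  also have "edges (complex_graph a vs b) =
      {(ws ! i, ws ! j) |i j. i < length ws \<and> j < length ws \<and> complex_index (length ws) i j}"
    using complex_graph_edges[OF False] unfolding ws_def .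
  finally show ?thesis
    unfolding is_minimal_complex_def complex_seq_def K ws_def[symmetric]
    using False len
    by (cases "distinct ws")
      (simp_all only: Int_Times_eq_nth_pairs_iff simp_thms)
qed

text \<open>The index change from \<open>i\<close> to \<open>length ws - Suc i\<close> swaps the two
  disjuncts of \<open>complex_index\<close>.\<close>

lemma complex_seq_rev:
  assumes "complex_seq G ws"
  shows "complex_seq G (rev ws)"
proof -
  let ?n = "length ws"
  have "(rev ws ! i, rev ws ! j) \<in> edges G \<longleftrightarrow> complex_index ?n i j" if "i < ?n" "j < ?n" for i j
  proof -
    have "(rev ws ! i, rev ws ! j) \<in> edges G \<longleftrightarrow> complex_index ?n (?n - Suc i) (?n - Suc j)"
      using assms that by (simp add: complex_seq_def rev_nth)
    also have "\<dots> \<longleftrightarrow> complex_index ?n i j"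
      using that unfolding complex_index_def by auto
    finally show ?thesis .
  qed
  then show ?thesis
    using assms by (simp add: complex_seq_def)
qed

lemma is_minimal_complex_rev:
  assumes "is_minimal_complex G a vs b"
  shows "is_minimal_complex G b (rev vs) a"
  using complex_seq_rev[OF assms[unfolded is_minimal_complex_iff_seq]]
  by (simp add: is_minimal_complex_iff_seq)

lemma csp_sym: "a \<in> csp G b \<longleftrightarrow> b \<in> csp G a"
  by (auto simp: csp_def dest: is_minimal_complex_rev)

lemma is_minimal_complexD:
  assumes "is_minimal_complex G a vs b"
  shows "vs \<noteq> []" "distinct vs" "a \<noteq> b" "a \<in> verts G" "b \<in> verts G" "set vs \<subseteq> verts G"
    "arrow G a (hd vs)" "arrow G b (last vs)" "successively (line G) vs"
    "\<not> adjacent G a b" "\<And>x. x \<in> set (butlast (tl vs)) \<Longrightarrow> \<not> adjacent G x a \<and> \<not> adjacent G x b"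
    "a \<notin> set vs" "b \<notin> set vs"
proof -
  let ?ws = "a # vs @ [b]"
  show basic: "vs \<noteq> []" "distinct vs" "a \<noteq> b" "a \<in> verts G" "b \<in> verts G" "set vs \<subseteq> verts G"
    "a \<notin> set vs" "b \<notin> set vs"
    using assms by (auto simp: is_minimal_complex_def)
  have pos: "(?ws ! i, ?ws ! j) \<in> edges G \<longleftrightarrow> complex_index (length vs + 2) i j"
    if "i < length vs + 2" "j < length vs + 2" for i j
    using assms that unfolding is_minimal_complex_iff_seq complex_seq_def
    by (metis (no_types, lifting) add_2_eq_Suc' length_Cons length_append_singleton)
  have vs: "vs ! i = ?ws ! Suc i" if "i < length vs" for i
    using that by (simp add: nth_append)
  have ends: "a = ?ws ! 0" "hd vs = ?ws ! 1" "b = ?ws ! Suc (length vs)" "last vs = ?ws ! length vs"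
    using basic(1) by (auto simp: nth_append hd_conv_nth last_conv_nth)
  have len: "0 < length vs"
    using basic(1) by simp
  show "arrow G a (hd vs)"
    using pos[of 0 1] pos[of 1 0] len unfolding arrow_def ends(2)
    by (simp add: complex_index_def)
  show "arrow G b (last vs)"
    using pos[of "Suc (length vs)" "length vs"] pos[of "length vs" "Suc (length vs)"] len ends(3,4)
    unfolding arrow_def by (simp add: complex_index_def)
  show "\<not> adjacent G a b"
    using pos[of 0 "Suc (length vs)"] pos[of "Suc (length vs)" 0] len ends(1,3)
    unfolding adjacent_iff by (simp add: complex_index_def)
  show "successively (line G) vs"
    unfolding successively_conv_nth line_def
  proof (intro allI impI)
    fix i assume "Suc i < length vs"
    then show "(vs ! i, vs ! Suc i) \<in> edges G \<and> (vs ! Suc i, vs ! i) \<in> edges G"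
      using pos[of "Suc i" "Suc (Suc i)"] pos[of "Suc (Suc i)" "Suc i"] vs[of i] vs[of "Suc i"]
      by (simp add: complex_index_def)
  qed
  \<comment> \<open>Such an \<open>x\<close> sits at one of the positions 2 to
    \<open>length vs - 1\<close> of \<open>?ws\<close>, at distance at least two from both
    ends.\<close>
  fix x assume "x \<in> set (butlast (tl vs))"
  then obtain i where i: "i < length (butlast (tl vs))" "x = butlast (tl vs) ! i"
    by (metis in_set_conv_nth)
  then have "x = ?ws ! Suc (Suc i)"
    by (simp add: nth_butlast nth_tl nth_append less_diff_conv)
  then show "\<not> adjacent G x a \<and> \<not> adjacent G x b"
    using i(1) ends(1,3) pos[of "Suc (Suc i)" 0] pos[of 0 "Suc (Suc i)"]
      pos[of "Suc (Suc i)" "Suc (length vs)"] pos[of "Suc (length vs)" "Suc (Suc i)"]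
    unfolding adjacent_iff by (simp add: complex_index_def)
qed

lemma is_minimal_complex_induced:
  assumes "A \<subseteq> verts G"
  shows "is_minimal_complex (induced G A) a vs b \<longleftrightarrow>
    is_minimal_complex G a vs b \<and> {a, b} \<union> set vs \<subseteq> A"
proof (cases "{a, b} \<union> set vs \<subseteq> A")
  case True
  then have "induced (induced G A) ({a, b} \<union> set vs) = induced G ({a, b} \<union> set vs)"
    by (auto simp: induced_def)
  then show ?thesis
    using assms True by (auto simp: is_minimal_complex_def induced_def)
qed (auto simp: is_minimal_complex_def induced_def)

section \<open>c-separation\<close>

lemma adjacent_sym: "adjacent G u v \<longleftrightarrow> adjacent G v u"
  by (auto simp: adjacent_iff)

text \<open>Adjacency and \<open>csp\<close> are symmetric, so every pair of the moral graph comes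
  with its converse.\<close>

lemma line_moral:
  "line (moral G) x y \<longleftrightarrow> x \<in> verts G \<and> y \<in> verts G \<and> (adjacent G x y \<or> x \<in> csp G y)"
  by (auto simp: line_def moral_def csp_sym adjacent_sym)

lemma c_separates_sym:
  assumes "c_separates G S A B"
  shows "c_separates G S B A"
  unfolding c_separates_def separates_def
proof (intro allI impI)
  let ?M = "moral (induced G (An G (B \<union> A \<union> S)))"
  fix xs assume xs: "undirected_path ?M xs \<and> hd xs \<in> B \<and> last xs \<in> A"
  have "line ?M x y \<longleftrightarrow> line ?M y x" for x y
    by (auto simp: line_def)
  then have "undirected_path ?M (rev xs)"
    using xs by (simp add: undirected_path_def)
  moreover have "B \<union> A \<union> S = A \<union> B \<union> S"
    by auto
  moreover have "hd (rev xs) \<in> A" "last (rev xs) \<in> B"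
    using xs by (auto simp: undirected_path_def hd_rev last_rev)
  ultimately have "set (rev xs) \<inter> S \<noteq> {}"
    using assms unfolding c_separates_def separates_def by metis
  then show "set xs \<inter> S \<noteq> {}" by simp
qed

lemma not_c_separates_if_moral_line:
  assumes "line (moral (induced G (An G ({u} \<union> {v} \<union> S)))) u v" "u \<noteq> v" "u \<notin> S" "v \<notin> S"
  shows "\<not> c_separates G S {u} {v}"
proof
  assume "c_separates G S {u} {v}"
  moreover have "undirected_path (moral (induced G (An G ({u} \<union> {v} \<union> S)))) [u, v]"
    using assms by (auto simp: undirected_path_def line_moral) (auto simp: moral_def)
  ultimately have "set [u, v] \<inter> S \<noteq> {}"
    unfolding c_separates_def separates_def by (metis insertI1 last.simps list.sel(1) list.simps(3))
  then show False using assms by auto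
qed

lemma subset_An: "A \<subseteq> An G A"
  by (auto simp: An_def)

lemma adjacent_not_c_separates:
  assumes "is_graph G" "adjacent G u v" "u \<notin> S" "v \<notin> S"
  shows "\<not> c_separates G S {u} {v}"
proof (rule not_c_separates_if_moral_line)
  have "adjacent (induced G (An G ({u} \<union> {v} \<union> S))) u v"
    using assms(2) subset_An[of "{u} \<union> {v} \<union> S" G] by (auto simp: adjacent_iff induced_def)
  then show "line (moral (induced G (An G ({u} \<union> {v} \<union> S)))) u v"
    using subset_An[of "{u} \<union> {v} \<union> S" G] by (simp add: line_moral induced_def)
  show "u \<noteq> v"
    using assms by (auto simp: adjacent_iff is_graph_def irrefl_def)
qed (use assms in auto)

lemma An_closed: "\<lbrakk>is_graph G; A \<subseteq> verts G; (x, y) \<in> edges G; y \<in> An G A\<rbrakk> \<Longrightarrow> x \<in> An G A"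
  by (simp add: An_eq) (blast intro: converse_rtrancl_into_rtrancl)

text \<open>Conditioning on \<open>hd vs\<close> pulls all of \<open>vs\<close> into the ancestral
  set. The complex then survives in the induced graph, and moralizing joins \<open>a\<close> to
  \<open>b\<close> directly.\<close>

lemma complex_not_c_separates:
  assumes "is_graph G" "is_minimal_complex G a vs b" "S \<subseteq> verts G" "a \<notin> S" "b \<notin> S"
  shows "\<not> c_separates G (S \<union> {hd vs}) {a} {b}"
proof (rule not_c_separates_if_moral_line)
  note D = is_minimal_complexD[OF assms(2)]
  let ?A = "An G ({a} \<union> {b} \<union> (S \<union> {hd vs}))"
  have sub: "{a} \<union> {b} \<union> (S \<union> {hd vs}) \<subseteq> verts G"
    using D(4-6) hd_in_set[OF D(1)] assms(3) by auto
  have "set vs \<subseteq> ?A"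
  proof
    fix x assume "x \<in> set vs"
    then obtain i where "i < length vs" "x = vs ! i"
      by (metis in_set_conv_nth)
    \<comment> \<open>Induction along the lines: each vertex of \<open>vs\<close> is a neighbour of
      the preceding one, hence in its boundary.\<close>
    moreover have "vs ! i \<in> ?A" if "i < length vs" for i
      using that
    proof (induction i)
      case 0
      then show ?case
        using subset_An[of "{a} \<union> {b} \<union> (S \<union> {hd vs})" G] D(1) by (auto simp: hd_conv_nth)
    next
      case (Suc i)
      then have "(vs ! Suc i, vs ! i) \<in> edges G"
        using D(9) by (auto simp: successively_conv_nth line_def)
      then show ?case
        using An_closed[OF assms(1) sub] Suc.IH[OF Suc_lessD[OF Suc.prems]] by blast
    qed
    ultimately show "x \<in> ?A" by simp
  qed
  moreover have "{a, b} \<subseteq> ?A"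
    using subset_An[of "{a} \<union> {b} \<union> (S \<union> {hd vs})" G] by auto
  ultimately have "is_minimal_complex (induced G ?A) a vs b"
    using assms(2) An_subset_verts[OF assms(1) sub] by (subst is_minimal_complex_induced) blast+
  then have "a \<in> csp (induced G ?A) b"
    unfolding csp_sym[of a] unfolding csp_def by blast
  then show "line (moral (induced G ?A)) a b"
    using \<open>{a, b} \<subseteq> ?A\<close> unfolding line_moral by (simp add: induced_def)
  show "a \<noteq> b" "a \<notin> S \<union> {hd vs}" "b \<notin> S \<union> {hd vs}"
    using hd_in_set[OF D(1)] D(3,12,13) assms(4,5) by auto
qed

section \<open>Separation by Markov blankets and boundaries\<close>

lemma c_separates_if_neighbours:
  assumes "\<And>x. line (moral (induced G (An G ({u} \<union> {v} \<union> S)))) u x \<Longrightarrow> x \<noteq> u \<Longrightarrow> x \<in> S"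
    and "u \<noteq> v"
  shows "c_separates G S {u} {v}"
  unfolding c_separates_def separates_def
proof (intro allI impI)
  let ?M = "moral (induced G (An G ({u} \<union> {v} \<union> S)))"
  fix xs assume xs: "undirected_path ?M xs \<and> hd xs \<in> {u} \<and> last xs \<in> {v}"
  \<comment> \<open>\<open>u \<noteq> v\<close> forces a second vertex on the path, and distinctness
    of the path makes it differ from \<open>u\<close>.\<close>
  then obtain x ys where "xs = u # x # ys"
    using assms(2) by (cases xs; cases "tl xs") (auto simp: undirected_path_def)
  then show "set xs \<inter> S \<noteq> {}"
    using xs assms(1)[of x] by (auto simp: undirected_path_def)
qed

text \<open>Adjacencies and minimal complexes of an induced subgraph are already present in
  \<open>G\<close>, so every moral neighbour of \<open>u\<close> lies in
  \<open>Mb G u\<close>.\<close>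

lemma Mb_c_separates:
  assumes "is_graph G" "u \<in> verts G" "v \<in> verts G" "Mb G u \<subseteq> verts G" "u \<noteq> v"
  shows "c_separates G (Mb G u) {u} {v}"
proof (rule c_separates_if_neighbours)
  let ?A = "An G ({u} \<union> {v} \<union> Mb G u)"
  have sub: "?A \<subseteq> verts G"
    using assms by (intro An_subset_verts) auto
  fix x assume x: "line (moral (induced G ?A)) u x"
  show "x \<in> Mb G u"
  proof (cases "adjacent (induced G ?A) u x")
    case True
    then have "(x, u) \<in> edges G \<or> arrow G u x"
      by (auto simp: adjacent_iff induced_def arrow_def)
    then show ?thesis
      using assms(1) by (auto simp: Mb_def bd_singleton ch_def)
  next
    case False
    then have "x \<in> csp (induced G ?A) u"
      using x by (simp add: line_moral csp_sym[of x])
    then have "x \<in> csp G u"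
      unfolding csp_def is_minimal_complex_induced[OF sub] by blast
    then show ?thesis
      by (simp add: Mb_def)
  qed
qed (use assms in auto)

text \<open>
  Unless \<open>v\<close> is a proper descendant of \<open>u\<close>, no child of \<open>u\<close> survives in the relevant ancestral set, so
  the moral neighbours of \<open>u\<close> there are exactly its boundary.
\<close>

lemma bd_c_separates:
  assumes G: "lwf_chain_graph G" and V: "u \<in> verts G" "v \<in> verts G" "u \<noteq> v"
    and desc: "(u, v) \<in> (edges G)\<^sup>* \<Longrightarrow> (v, u) \<in> (edges G)\<^sup>*"
  shows "c_separates G (bd G {u}) {u} {v}"
proof (rule c_separates_if_neighbours)
  note g = is_graph_lwf[OF G]
  let ?B = "{u} \<union> {v} \<union> bd G {u}"
  have B: "?B \<subseteq> verts G"
    using V g by (auto simp: bd_singleton is_graph_def)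
  note sub = An_subset_verts[OF g B]
  have no_child: "x \<notin> An G ?B" if "arrow G u x" for x
  proof
    assume "x \<in> An G ?B"
    \<comment> \<open>An ancestor of a boundary vertex of \<open>u\<close> is an ancestor of
      \<open>u\<close>.\<close>
    then have "(x, u) \<in> (edges G)\<^sup>* \<or> (x, v) \<in> (edges G)\<^sup>*"
      unfolding An_eq[OF g B] by (auto simp: bd_singleton[OF g] intro: rtrancl_into_rtrancl)
    moreover have "(x, u) \<notin> (edges G)\<^sup>*"
      by (rule arrow_not_rtrancl[OF G that])
    ultimately have xv: "(x, v) \<in> (edges G)\<^sup>*" by simp
    then have "(u, v) \<in> (edges G)\<^sup>*"
      using that by (auto simp: arrow_def intro: converse_rtrancl_into_rtrancl)
    \<comment> \<open>\<open>desc\<close> supplies a walk from \<open>v\<close> back to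
      \<open>u\<close>, which would close a cycle through the arrow from \<open>u\<close> to
      \<open>x\<close>.\<close>
    then have "(x, u) \<in> (edges G)\<^sup>*"
      using desc xv by (auto intro: rtrancl_trans)
    then show False
      using arrow_not_rtrancl[OF G that] by simp
  qed
  fix x assume x: "line (moral (induced G (An G ?B))) u x"
  then have mem: "x \<in> An G ?B"
    by (simp add: line_moral) (simp add: induced_def)
  show "x \<in> bd G {u}"
  proof (cases "adjacent (induced G (An G ?B)) u x")
    case True
    then have "(x, u) \<in> edges G \<or> arrow G u x"
      by (auto simp: adjacent_iff induced_def arrow_def)
    then show ?thesis
      using no_child mem by (auto simp: bd_singleton[OF g])
  next
    case False
    then have "x \<in> csp (induced G (An G ?B)) u"
      using x by (simp add: line_moral csp_sym[of x])
    then obtain vs where vs: "is_minimal_complex G u vs x" "set vs \<subseteq> An G ?B"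
      unfolding csp_def is_minimal_complex_induced[OF sub] by blast
    \<comment> \<open>A complex between \<open>u\<close> and \<open>x\<close> would put the child
      \<open>hd vs\<close> of \<open>u\<close> into the ancestral set.\<close>
    then have "hd vs \<in> An G ?B"
      using is_minimal_complexD(1)[OF vs(1)] hd_in_set by blast
    then show ?thesis
      using no_child[OF is_minimal_complexD(7)[OF vs(1)]] by simp
  qed
qed (use V in auto)

text \<open>Adding \<open>w\<close> leaves the ancestral set, and with it the moral graph,
  unchanged; in a fixed graph a larger set still separates.\<close>

lemma c_separates_insert_An:
  assumes "is_graph G" "A \<union> B \<union> S \<subseteq> verts G" "w \<in> An G (A \<union> B \<union> S)" "c_separates G S A B"
  shows "c_separates G (S \<union> {w}) A B"
proof -
  have "An G (A \<union> B \<union> (S \<union> {w})) = An G (A \<union> B \<union> S)"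
  proof
    have sub: "A \<union> B \<union> (S \<union> {w}) \<subseteq> verts G"
      using assms(2,3) An_subset_verts[OF assms(1,2)] by auto
    show "An G (A \<union> B \<union> (S \<union> {w})) \<subseteq> An G (A \<union> B \<union> S)"
    proof
      fix x assume "x \<in> An G (A \<union> B \<union> (S \<union> {w}))"
      then have "(\<exists>a\<in>A \<union> B \<union> S. (x, a) \<in> (edges G)\<^sup>*) \<or> (x, w) \<in> (edges G)\<^sup>*"
        unfolding An_eq[OF assms(1) sub] by blast
      then show "x \<in> An G (A \<union> B \<union> S)"
        using assms(3) unfolding An_eq[OF assms(1,2)] by (blast intro: rtrancl_trans)
    qed
    show "An G (A \<union> B \<union> S) \<subseteq> An G (A \<union> B \<union> (S \<union> {w}))"
      by (auto simp: An_def)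
  qed
  then show ?thesis
    using assms(4) unfolding c_separates_def separates_def by (simp add: Int_Un_distrib)
qed

lemma Mb_subset_verts: "\<lbrakk>is_graph G; u \<in> verts G\<rbrakk> \<Longrightarrow> Mb G u \<subseteq> verts G - {u}"
  by (auto simp: Mb_def bd_singleton ch_def arrow_def is_graph_def irrefl_def csp_def
      dest: is_minimal_complexD(3,5))

lemma Mb_sym:
  assumes "is_graph G"
  shows "u \<in> Mb G v \<longleftrightarrow> v \<in> Mb G u"
  using assms csp_sym[of u G v] by (auto simp: Mb_def bd_singleton ch_def arrow_def)

lemma adjacent_in_Mb: "\<lbrakk>is_graph G; adjacent G u v\<rbrakk> \<Longrightarrow> v \<in> Mb G u"
  by (auto simp: Mb_def bd_singleton ch_def arrow_def adjacent_iff)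

section \<open>Graphs that keep the complex arrows\<close>

text \<open>Restates the condition on \<open>hd vs\<close> and \<open>a\<close> for positions 1 and
  0 of the combined list.\<close>

lemma complex_seq_first:
  assumes "complex_seq G ws" "\<And>a vs b. is_minimal_complex G a vs b \<Longrightarrow> (hd vs, a) \<notin> edges F"
  shows "(ws ! 1, ws ! 0) \<notin> edges F"
proof -
  have len: "length ws \<ge> 3"
    using assms(1) by (simp add: complex_seq_def)
  then obtain a xs where xs: "ws = a # xs" "length xs \<ge> 2"
    by (cases ws) auto
  then obtain vs b where vs: "xs = vs @ [b]"
    by (cases xs rule: rev_cases) auto
  then have "vs \<noteq> []"
    using xs by auto
  then have "ws ! 1 = hd vs" "ws ! 0 = a"
    using xs vs by (simp_all add: nth_append hd_conv_nth)
  then show ?thesis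
    using assms xs vs by (auto simp: is_minimal_complex_iff_seq)
qed

text \<open>The last arrow of a minimal complex is kept as well, since complexes can be reversed.\<close>

definition keeps_complexes :: "'v mgraph \<Rightarrow> 'v mgraph \<Rightarrow> bool" where
  "keeps_complexes G F \<longleftrightarrow>
     verts F = verts G \<and> edges G \<subseteq> edges F \<and> edges F \<subseteq> edges G \<union> (edges G)\<inverse> \<and>
     (\<forall>a vs b. is_minimal_complex G a vs b \<longrightarrow> (hd vs, a) \<notin> edges F)"

context
  fixes G F :: "'v mgraph"
  assumes keeps: "keeps_complexes G F"
begin

text \<open>By the two inclusions, \<open>F\<close> arises from \<open>G\<close> by turning some
  arrows into lines.\<close>

lemma verts_F: "verts F = verts G"
  and edges_mono: "edges G \<subseteq> edges F"
  and edges_orient: "edges F \<subseteq> edges G \<union> (edges G)\<inverse>"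
  and kept: "is_minimal_complex G a vs b \<Longrightarrow> (hd vs, a) \<notin> edges F"
  using keeps unfolding keeps_complexes_def by blast+

text \<open>An excess pair of \<open>F\<close> would reverse an arrow of \<open>G\<close> inside the
  complex. The only arrows there are the two outer ones, and both stay arrows in
  \<open>F\<close>.\<close>

lemma complex_seq_extend:
  assumes "complex_seq G ws"
  shows "complex_seq F ws"
proof -
  let ?n = "length ws"
  note pos = assms[unfolded complex_seq_def, THEN conjunct2, THEN conjunct2, THEN conjunct2, rule_format]
  have len: "?n \<ge> 3"
    using assms by (simp add: complex_seq_def)
  have first: "(ws ! 1, ws ! 0) \<notin> edges F"
    by (rule complex_seq_first[OF assms kept])
  have "(rev ws ! 1, rev ws ! 0) \<notin> edges F"
    by (rule complex_seq_first[OF complex_seq_rev[OF assms] kept])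
  then have last: "(ws ! (?n - 2), ws ! (?n - 1)) \<notin> edges F"
    using rev_nth[of 0 ws] rev_nth[of 1 ws] length_greater_0_conv[of ws]
    by (metis One_nat_def Suc_1 assms complex_seq_def less_eq_Suc_le numeral_3_eq_3 Suc_leD)
  have "(ws ! i, ws ! j) \<in> edges F \<longleftrightarrow> complex_index ?n i j" if ij: "i < ?n" "j < ?n" for i j
  proof
    assume F: "(ws ! i, ws ! j) \<in> edges F"
    show "complex_index ?n i j"
    proof (rule ccontr)
      assume no: "\<not> complex_index ?n i j"
      then have "(ws ! j, ws ! i) \<in> edges G"
        using F edges_orient pos[OF ij] by auto
      then have "complex_index ?n j i"
        using pos[OF ij(2,1)] by simp
      then have "i = 1 \<and> j = 0 \<or> i = ?n - 2 \<and> j = ?n - 1"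
        using no ij unfolding complex_index_def by auto
      then show False
        using F first last by auto
    qed
  next
    assume "complex_index ?n i j"
    then show "(ws ! i, ws ! j) \<in> edges F"
      using pos[OF ij] edges_mono by auto
  qed
  then show ?thesis
    using assms verts_F by (simp add: complex_seq_def)
qed

text \<open>
  A rightward arrow of \<open>G\<close> inside the line part would be followed by a first leftward arrow (the last
  edge is one); the last rightward arrow before it then starts a minimal complex of \<open>G\<close> whose first
  edge is a line in \<open>F\<close>.
\<close>

lemma complex_seq_inner_reverse_edge:
  assumes ws: "complex_seq F ws" and k: "0 < k" "Suc (Suc k) < length ws"
  shows "(ws ! Suc k, ws ! k) \<in> edges G"
proof (rule ccontr)
  let ?n = "length ws"
  note pos = ws[unfolded complex_seq_def, THEN conjunct2, THEN conjunct2, THEN conjunct2, rule_format]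
  \<comment> \<open>Positions \<open>i\<close> and \<open>Suc i\<close> are adjacent in
    \<open>G\<close>, so \<open>R i\<close> says that the edge between them is an arrow to the right
    and \<open>L i\<close> that it is an arrow to the left.\<close>
  define R where "R i \<longleftrightarrow> (ws ! Suc i, ws ! i) \<notin> edges G" for i
  define L where "L i \<longleftrightarrow> (ws ! i, ws ! Suc i) \<notin> edges G" for i
  assume "(ws ! Suc k, ws ! k) \<notin> edges G"
  then have Rk: "R k" by (simp add: R_def)
  have RL: "\<not> (R i \<and> L i)" if "Suc i < ?n" for i
  proof -
    have "complex_index ?n i (Suc i) \<or> complex_index ?n (Suc i) i"
      using that k unfolding complex_index_def by auto
    then have "(ws ! i, ws ! Suc i) \<in> edges F \<or> (ws ! Suc i, ws ! i) \<in> edges F"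
      using pos that by auto
    then show ?thesis
      using edges_orient by (auto simp: R_def L_def)
  qed
  \<comment> \<open>The edge at \<open>?n - 2\<close> is the final arrow of the complex;
    \<open>F\<close> lacks its rightward pair, and hence so does \<open>G\<close>.\<close>
  have "\<not> complex_index ?n (?n - 2) (Suc (?n - 2))"
    using k by (auto simp: complex_index_def)
  moreover have "Suc (?n - 2) < ?n"
    using k by arith
  ultimately have "L (?n - 2)"
    using pos[of "?n - 2" "Suc (?n - 2)"] edges_mono k by (auto simp: L_def)
  then have ex: "k < ?n - 2 \<and> L (?n - 2)"
    using k by auto
  \<comment> \<open>The first leftward arrow after position \<open>k\<close>.\<close>
  define m where "m = (LEAST m. k < m \<and> L m)"
  have m: "k < m" "L m" "m \<le> ?n - 2"
    using LeastI[of "\<lambda>m. k < m \<and> L m", OF ex] Least_le[of "\<lambda>m. k < m \<and> L m", OF ex]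
    by (auto simp: m_def)
  have m_min: "\<not> L i" if "k < i" "i < m" for i
    using that not_less_Least[of i "\<lambda>m. k < m \<and> L m"] by (auto simp: m_def)
  \<comment> \<open>The last rightward arrow before \<open>m\<close>; position \<open>k\<close> is a
    candidate, whence \<open>k \<le> l\<close>.\<close>
  define l where "l = Max {i. i < m \<and> R i}"
  have "l \<in> {i. i < m \<and> R i}"
    unfolding l_def by (rule Max_in) (use m Rk in auto)
  then have l: "l < m" "R l" by auto
  have kl: "k \<le> l"
    unfolding l_def by (rule Max_ge) (use m Rk in auto)
  have l_max: "\<not> R i" if "l < i" "i < m" for i
  proof
    assume "R i"
    then have "i \<le> l"
      unfolding l_def using that by (intro Max_ge) auto
    then show False using that by simp
  qed
  \<comment> \<open>The window of positions \<open>l\<close> to \<open>m + 1\<close>, which contains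
    both extremal arrows entirely.\<close>
  define us where "us = take (m + 2 - l) (drop l ws)"
  have len: "length us = m + 2 - l"
    using m l k by (simp add: us_def)
  have nth: "us ! i = ws ! (l + i)" if "i < m + 2 - l" for i
    using that m l k by (simp add: us_def)
  have "complex_seq G us"
    unfolding complex_seq_def
  proof (intro conjI allI impI)
    show "length us \<ge> 3" using len l by simp
    show "distinct us" using ws by (simp add: us_def complex_seq_def)
    show "set us \<subseteq> verts G"
      using ws verts_F by (auto simp: us_def complex_seq_def dest!: in_set_takeD in_set_dropD)
    fix i j assume "i < length us" "j < length us"
    then have ij: "i < m + 2 - l" "j < m + 2 - l" using len by auto
    then have ij': "l + i < ?n" "l + j < ?n" using m k by auto
    show "(us ! i, us ! j) \<in> edges G \<longleftrightarrow> complex_index (length us) i j"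
      unfolding len nth[OF ij(1)] nth[OF ij(2)]
    proof -
      consider (right) "j = Suc i" | (left) "i = Suc j" | (far) "j \<noteq> Suc i" "i \<noteq> Suc j"
        by blast
      then show "(ws ! (l + i), ws ! (l + j)) \<in> edges G \<longleftrightarrow> complex_index (m + 2 - l) i j"
      proof cases
        case right
        then have "l + i \<le> m" using ij by auto
        \<comment> \<open>Strictly between \<open>l\<close> and \<open>m\<close> there is no
          leftward arrow by the choice of \<open>m\<close>; at \<open>l\<close> itself the arrow
          points right.\<close>
        then have "\<not> L (l + i) \<longleftrightarrow> l + i < m"
          using m(2) m_min[of "l + i"] kl l RL[of l] ij' right by (cases i) (auto simp: le_less)
        then show ?thesis
          using right ij unfolding L_def complex_index_def by auto
      next
        case left
        then have "l + j \<le> m" using ij by auto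
        then have "\<not> R (l + j) \<longleftrightarrow> 0 < j"
          using m(2) l_max[of "l + j"] l RL[of m] ij' left by (cases j) (auto simp: le_less)
        then show ?thesis
          using left unfolding R_def complex_index_def by auto
      next
        case far
        then have "(ws ! (l + i), ws ! (l + j)) \<notin> edges F"
          using pos[OF ij'] by (auto simp: complex_index_def)
        then show ?thesis
          using far edges_mono by (auto simp: complex_index_def)
      qed
    qed
  qed
  then have "(us ! 1, us ! 0) \<notin> edges F"
    by (rule complex_seq_first[OF _ kept])
  moreover have "us ! 1 = ws ! Suc l" "us ! 0 = ws ! l"
    using nth[of 0] nth[of 1] l by auto
  moreover have "(ws ! Suc l, ws ! l) \<in> edges F"
    using pos[of "Suc l" l] kl k l m by (auto simp: complex_index_def)
  \<comment> \<open>Because \<open>0 < k \<le> l\<close>, the edge at \<open>l\<close> is not the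
    initial arrow of the complex in \<open>F\<close>, so its backward pair belongs to
    \<open>F\<close>.\<close>
  ultimately show False by simp
qed

text \<open>Arrows of \<open>F\<close> are arrows of \<open>G\<close>. For the inner lines, one
  direction comes from the preceding lemma and the other from applying it to the reversed
  list.\<close>

lemma complex_seq_reflect:
  assumes ws: "complex_seq F ws"
  shows "complex_seq G ws"
proof -
  let ?n = "length ws"
  note pos = ws[unfolded complex_seq_def, THEN conjunct2, THEN conjunct2, THEN conjunct2, rule_format]
  have len: "?n \<ge> 3"
    using ws by (simp add: complex_seq_def)
  \<comment> \<open>If \<open>G\<close> had only the converse pair, \<open>F\<close> would contain
    it too.\<close>
  have outer: "(ws ! i, ws ! j) \<in> edges G"
    if "i < ?n" "j < ?n" "complex_index ?n i j" "\<not> complex_index ?n j i" for i j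
    using that pos[of i j] pos[of j i] edges_mono edges_orient by auto
  have "(ws ! i, ws ! j) \<in> edges G \<longleftrightarrow> complex_index ?n i j" if ij: "i < ?n" "j < ?n" for i j
  proof
    assume "(ws ! i, ws ! j) \<in> edges G"
    then show "complex_index ?n i j"
      using pos[OF ij] edges_mono by auto
  next
    assume c: "complex_index ?n i j"
    show "(ws ! i, ws ! j) \<in> edges G"
    proof (cases "complex_index ?n j i")
      case True
      then consider (left) "i = Suc j" "0 < j" "Suc i < ?n" | (right) "j = Suc i" "0 < i" "Suc j < ?n"
        using c unfolding complex_index_def by auto
      then show ?thesis
      proof cases
        case left
        then show ?thesis
          using complex_seq_inner_reverse_edge[OF ws, of j] by simp
      next
        case right
        \<comment> \<open>The position of \<open>ws ! Suc i\<close> in the reversed list.\<close>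
        define k where "k = ?n - 2 - i"
        have "rev ws ! k = ws ! Suc i" "rev ws ! Suc k = ws ! i"
          using right by (auto simp: k_def rev_nth intro!: arg_cong[of _ _ "\<lambda>x. ws ! x"])
        moreover have "0 < k" "Suc (Suc k) < length (rev ws)"
          using right by (auto simp: k_def)
        ultimately show ?thesis
          using complex_seq_inner_reverse_edge[OF complex_seq_rev[OF ws], of k] right by simp
      qed
    qed (use outer ij c in auto)
  qed
  then show ?thesis
    using ws verts_F by (simp add: complex_seq_def)
qed

lemma minimal_complexes_eq: "minimal_complexes G = minimal_complexes F"
  unfolding minimal_complexes_def is_minimal_complex_iff_seq
  using complex_seq_extend complex_seq_reflect by blast

end

section \<open>Skeleton recovery\<close>

text \<open>These are the queries that the skeleton and orientation phases rely on; from here on the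
  argument is purely about graphs.\<close>

definition ci_oracle :: "'v mgraph \<Rightarrow> ('v set \<Rightarrow> 'v set \<Rightarrow> 'v set \<Rightarrow> bool) \<Rightarrow> bool" where
  "ci_oracle G ind \<longleftrightarrow>
     (\<forall>u\<in>verts G. \<forall>v\<in>verts G. \<forall>Z \<subseteq> verts G - {u, v}. u \<noteq> v \<longrightarrow>
        (ind {u} {v} Z \<longleftrightarrow> c_separates G Z {u} {v}))"

lemma ci_oracle_cond_indep:
  assumes "global_markov G N p" "faithful G N p"
  shows "ci_oracle G (cond_indep N p)"
  unfolding ci_oracle_def
proof (intro ballI allI impI)
  fix u v Z assume uv: "u \<in> verts G" "v \<in> verts G" "Z \<subseteq> verts G - {u, v}" "u \<noteq> v"
  have "\<not> c_separates G Z {u} {v} \<Longrightarrow> \<not> cond_indep N p {u} {v} Z"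
    using assms(2)[unfolded faithful_def, rule_format, OF uv(1-3)] uv(4) by simp
  moreover have "c_separates G Z {u} {v} \<Longrightarrow> cond_indep N p {u} {v} Z"
    using assms(1)[unfolded global_markov_def, rule_format, of "{u}" "{v}" Z] uv by auto
  ultimately show "cond_indep N p {u} {v} Z \<longleftrightarrow> c_separates G Z {u} {v}"
    by blast
qed

lemma ci_oracleD:
  "\<lbrakk>ci_oracle G ind; u \<in> verts G; v \<in> verts G; u \<noteq> v; Z \<subseteq> verts G - {u, v}\<rbrakk> \<Longrightarrow>
   ind {u} {v} Z \<longleftrightarrow> c_separates G Z {u} {v}"
  by (simp add: ci_oracle_def)

text \<open>Only pairs missing from \<open>H\<close> constrain \<open>sep\<close>, since unassigned
  entries are arbitrary. The condition does not depend on the phase that supplied the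
  separator.\<close>

definition skeleton_inv :: "'v mgraph \<Rightarrow> 'v mgraph \<Rightarrow> ('v \<times> 'v \<Rightarrow> 'v set) \<Rightarrow> bool" where
  "skeleton_inv G H sep \<longleftrightarrow>
     verts H = verts G \<and> edges H \<subseteq> verts G \<times> verts G \<and> irrefl (edges H) \<and> sym (edges H) \<and>
     edges G \<subseteq> edges H \<and>
     (\<forall>u\<in>verts G. \<forall>v\<in>verts G. u \<noteq> v \<and> (u, v) \<notin> edges H \<longrightarrow>
        sep (u, v) \<subseteq> verts G - {u, v} \<and> c_separates G (sep (u, v)) {u} {v})"

lemma skeleton_invD:
  assumes "skeleton_inv G H sep"
  shows "verts H = verts G" "edges H \<subseteq> verts G \<times> verts G" "irrefl (edges H)" "sym (edges H)"
    "edges G \<subseteq> edges H"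
    "\<lbrakk>u \<in> verts G; v \<in> verts G; u \<noteq> v; (u, v) \<notin> edges H\<rbrakk> \<Longrightarrow>
      sep (u, v) \<subseteq> verts G - {u, v} \<and> c_separates G (sep (u, v)) {u} {v}"
  using assms unfolding skeleton_inv_def by simp_all

lemma skeleton_inv_edgeD:
  assumes "skeleton_inv G H sep" "(u, v) \<in> edges H"
  shows "u \<in> verts G" "v \<in> verts G" "u \<noteq> v" "(v, u) \<in> edges H"
  using assms(2) skeleton_invD(2,3)[OF assms(1)] symD[OF skeleton_invD(4)[OF assms(1)]]
  by (auto simp: irrefl_def)

lemma skeleton_inv_ad:
  assumes "skeleton_inv G H sep"
  shows "ad H u = {v. (u, v) \<in> edges H}"
  using skeleton_inv_edgeD(4)[OF assms] by (auto simp: ad_def adjacent_iff)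

text \<open>Blanket membership is symmetric, so for a pair missing from the blanket graph neither
  vertex lies in the blanket of the other; then either blanket separates, however ties are
  broken.\<close>

lemma skeleton_inv_blanket:
  assumes g: "is_graph G" and mb: "\<forall>x\<in>verts G. mb x = Mb G x"
    and sep: "blanket_separators (verts G) mb sep"
  shows "skeleton_inv G (blanket_graph (verts G) mb) sep"
  unfolding skeleton_inv_def
proof (intro conjI ballI impI)
  let ?H = "blanket_graph (verts G) mb"
  show "verts ?H = verts G" "edges ?H \<subseteq> verts G \<times> verts G" "irrefl (edges ?H)" "sym (edges ?H)"
    by (auto simp: blanket_graph_def irrefl_def sym_def)
  show "edges G \<subseteq> edges ?H"
  proof (rule subrelI)
    fix x y assume e: "(x, y) \<in> edges G"
    then have "x \<in> verts G" "y \<in> verts G" "x \<noteq> y"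
      using g by (auto simp: is_graph_def irrefl_def)
    moreover have "y \<in> Mb G x" "x \<in> Mb G y"
      using e adjacent_in_Mb[OF g] by (auto simp: adjacent_iff)
    ultimately show "(x, y) \<in> edges ?H"
      using mb by (simp add: blanket_graph_def)
  qed
  fix u v assume uv: "u \<in> verts G" "v \<in> verts G" "u \<noteq> v \<and> (u, v) \<notin> edges ?H"
  have mb_uv: "mb u = Mb G u" "mb v = Mb G v"
    using mb uv(1,2) by blast+
  have "\<not> (v \<in> mb u \<and> u \<in> mb v)"
    using uv by (auto simp: blanket_graph_def)
  then have no: "u \<notin> Mb G v" "v \<notin> Mb G u"
    unfolding mb_uv using Mb_sym[OF g] by blast+
  have "sep (u, v) = mb u \<or> sep (u, v) = mb v"
    using sep uv no unfolding blanket_separators_def mb_uv[symmetric] by blast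
  then consider "sep (u, v) = Mb G u" | "sep (u, v) = Mb G v"
    unfolding mb_uv by blast
  then have "sep (u, v) \<subseteq> verts G - {u, v} \<and> c_separates G (sep (u, v)) {u} {v}"
  proof cases
    case 1
    then show ?thesis
      using Mb_subset_verts[OF g uv(1)] Mb_c_separates[OF g uv(1,2)] uv(3) no(2)
      by (simp only: 1) blast
  next
    case 2
    then show ?thesis
      using Mb_subset_verts[OF g uv(2)] c_separates_sym[OF Mb_c_separates[OF g uv(2,1)]] uv(3) no(1)
      by (simp only: 2) blast
  qed
  then show "sep (u, v) \<subseteq> verts G - {u, v}" "c_separates G (sep (u, v)) {u} {v}"
    by auto
qed

text \<open>Adjacent vertices are never c-separated, so the deleted edge is not an edge of
  \<open>G\<close>. Symmetry of c-separation permits storing \<open>S\<close> for both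
  orders.\<close>

lemma skeleton_inv_delete:
  assumes g: "is_graph G" and inv: "skeleton_inv G H sep"
    and uv: "(u, v) \<in> edges H" and S: "S \<subseteq> verts G - {u, v}" "c_separates G S {u} {v}"
  shows "skeleton_inv G (delete_edge u v H) (sep((u, v) := S, (v, u) := S))"
    (is "skeleton_inv G _ ?sep")
proof -
  note D = skeleton_invD[OF inv]
  have "\<not> adjacent G u v"
    using adjacent_not_c_separates[OF g, of u v S] S by auto
  then have "edges G \<subseteq> edges (delete_edge u v H)"
    using D(5) by (auto simp: delete_edge_def adjacent_iff)
  moreover have "irrefl (edges (delete_edge u v H))"
    using D(3) by (simp add: delete_edge_def irrefl_def)
  moreover have "sym (edges (delete_edge u v H))"
  proof (rule symI)
    fix x y assume "(x, y) \<in> edges (delete_edge u v H)"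
    then show "(y, x) \<in> edges (delete_edge u v H)"
      using symD[OF D(4), of x y] by (auto simp: delete_edge_def)
  qed
  moreover have "?sep (x, y) \<subseteq> verts G - {x, y} \<and> c_separates G (?sep (x, y)) {x} {y}"
    if "x \<in> verts G" "y \<in> verts G" "x \<noteq> y" "(x, y) \<notin> edges (delete_edge u v H)" for x y
  proof (cases "(x, y) = (u, v) \<or> (x, y) = (v, u)")
    case True
    then have "?sep (x, y) = S"
      by auto
    moreover have "S \<subseteq> verts G - {x, y}" "c_separates G S {x} {y}"
      using True S c_separates_sym[OF S(2)] by blast+
    ultimately show ?thesis
      by (simp only: simp_thms)
  next
    case False
    then have ne: "(x, y) \<noteq> (v, u)" "(x, y) \<noteq> (u, v)"
      by blast+
    then have "(x, y) \<notin> edges H"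
      using that(4) unfolding delete_edge_def by simp
    then have "sep (x, y) \<subseteq> verts G - {x, y} \<and> c_separates G (sep (x, y)) {x} {y}"
      using D(6) that(1-3) by simp
    then show ?thesis
      by (simp only: fun_upd_other[OF ne(1)] fun_upd_other[OF ne(2)])
  qed
  moreover have "verts (delete_edge u v H) = verts G"
    "edges (delete_edge u v H) \<subseteq> verts G \<times> verts G"
    using D(1,2) by (auto simp: delete_edge_def)
  ultimately show ?thesis
    unfolding skeleton_inv_def by simp
qed

section \<open>Exhaustive search over the rounds\<close>

definition no_separator :: "('v set \<Rightarrow> 'v set \<Rightarrow> 'v set \<Rightarrow> bool) \<Rightarrow> nat \<Rightarrow> 'v mgraph \<Rightarrow> 'v \<Rightarrow> 'v \<Rightarrow> bool"
  where "no_separator ind i H u v \<longleftrightarrow> (\<nexists>S. S \<subseteq> ad H u - {v} \<and> card S = i \<and> ind {u} {v} S)"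

text \<open>Deleting edges only removes candidate sets, so a search that failed once remains
  failed.\<close>

lemma no_separator_mono: "\<lbrakk>no_separator ind i H u v; ad H' u \<subseteq> ad H u\<rbrakk> \<Longrightarrow> no_separator ind i H' u v"
  unfolding no_separator_def by blast

lemma skel_step_inv:
  assumes g: "is_graph G" and ind: "ci_oracle G ind"
    and step: "skel_step ind i (H, sep, T) (H', sep', T')"
    and inv: "skeleton_inv G H sep"
    and T: "\<forall>(u, v)\<in>T. (u, v) \<in> edges H \<longrightarrow> no_separator ind i H u v"
  shows "skeleton_inv G H' sep' \<and> edges H' \<subseteq> edges H \<and>
    (\<forall>(u, v)\<in>T'. (u, v) \<in> edges H' \<longrightarrow> no_separator ind i H' u v)"
  using step
proof cases
  case (remove u v S)
  have uv: "(u, v) \<in> edges H"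
    using remove(4) skeleton_inv_edgeD(4)[OF inv]
    by (simp add: selectable_def skeleton_inv_ad[OF inv])
  then have *: "u \<in> verts G" "v \<in> verts G" "u \<noteq> v" "S \<subseteq> verts G - {u, v}"
    using skeleton_inv_edgeD[OF inv] remove(5) unfolding skeleton_inv_ad[OF inv] by blast+
  have "c_separates G S {u} {v}"
    using ci_oracleD[OF ind *] remove by blast
  then have inv': "skeleton_inv G H' sep'"
    using skeleton_inv_delete[OF g inv uv *(4)] remove(1,2) by simp
  have sub: "edges H' \<subseteq> edges H"
    unfolding remove(1) by (auto simp: delete_edge_def)
  then have ad: "ad H' x \<subseteq> ad H x" for x
    unfolding skeleton_inv_ad[OF inv] skeleton_inv_ad[OF inv'] by auto
  have "no_separator ind i H' x y" if xy: "(x, y) \<in> T'" "(x, y) \<in> edges H'" for x y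
  proof -
    \<comment> \<open>The newly treated pair has just lost its edge, so only pairs treated earlier
      matter.\<close>
    have "(x, y) \<in> T"
      using xy unfolding remove(1,3) by (auto simp: delete_edge_def)
    then show ?thesis
      using xy(2) sub T ad by (blast intro: no_separator_mono)
  qed
  then show ?thesis
    using inv' sub by blast
next
  case (keep u v)
  then show ?thesis
    using inv T by (auto simp: no_separator_def)
qed

lemma skel_steps_inv:
  assumes g: "is_graph G" and ind: "ci_oracle G ind" and inv: "skeleton_inv G H sep"
    and steps: "(skel_step ind i)\<^sup>*\<^sup>* (H, sep, {}) (H', sep', T')"
  shows "skeleton_inv G H' sep' \<and> edges H' \<subseteq> edges H \<and>
    (\<forall>(u, v)\<in>T'. (u, v) \<in> edges H' \<longrightarrow> no_separator ind i H' u v)"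
  using steps
proof (induction "(H', sep', T')" arbitrary: H' sep' T' rule: rtranclp_induct)
  case base
  then show ?case using inv by simp
next
  case (step y)
  obtain H1 sep1 T1 where y: "y = (H1, sep1, T1)"
    by (cases y)
  note IH = step.hyps(3)[OF y]
  then show ?case
    using skel_step_inv[OF g ind step.hyps(2)[unfolded y]] by blast
qed

text \<open>When round \<open>i\<close> ends, an edge that is still present either was treated
  without success or has too few adjacent vertices to offer a set of size \<open>i\<close>.\<close>

lemma skel_rounds_inv:
  assumes g: "is_graph G" and ind: "ci_oracle G ind"
    and rounds: "skel_rounds ind n H sep H' sep'" and inv: "skeleton_inv G H sep"
  shows "skeleton_inv G H' sep' \<and>
    (\<forall>(u, v)\<in>edges H'. \<forall>i<n. no_separator ind i H' u v)"
  using rounds inv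
proof induction
  case (start H sep)
  then show ?case by simp
next
  case (round i H sep H' sep' H'' sep'' T)
  then have inv': "skeleton_inv G H' sep'"
    and old: "\<forall>(u, v)\<in>edges H'. \<forall>j<i. no_separator ind j H' u v"
    by auto
  have inv'': "skeleton_inv G H'' sep''" and sub: "edges H'' \<subseteq> edges H'"
    and T: "\<forall>(u, v)\<in>T. (u, v) \<in> edges H'' \<longrightarrow> no_separator ind i H'' u v"
    using skel_steps_inv[OF g ind inv' round.hyps(2)] by auto
  have ad: "ad H'' x \<subseteq> ad H' x" for x
    using sub unfolding skeleton_inv_ad[OF inv'] skeleton_inv_ad[OF inv''] by auto
  have "no_separator ind j H'' u v" if uv: "(u, v) \<in> edges H''" and j: "j < Suc i" for u v j
  proof (cases "j < i")
    case True
    then show ?thesis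
      using old uv sub ad by (blast intro: no_separator_mono)
  next
    case False
    then have [simp]: "j = i" using j by simp
    have "\<not> selectable i H'' T u v"
      using round.hyps(3) by blast
    moreover have "u \<in> ad H'' v"
      using skeleton_inv_edgeD(4)[OF inv'' uv] by (simp add: skeleton_inv_ad[OF inv''])
    ultimately consider "(u, v) \<in> T" | "card (ad H'' u - {v}) < i"
      by (auto simp: selectable_def not_le)
    then show ?thesis
    proof cases
      case 1
      then show ?thesis using T uv by auto
    next
      case 2
      have "ad H'' u \<subseteq> verts G"
        using skeleton_inv_edgeD(2)[OF inv''] unfolding skeleton_inv_ad[OF inv''] by auto
      then have "finite (ad H'' u - {v})"
        using g finite_subset by (auto simp: is_graph_def)
      then show ?thesis
        using 2 card_mono unfolding no_separator_def by (metis \<open>j = i\<close> leD)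
    qed
  qed
  then show ?case
    using inv'' by blast
qed

text \<open>The boundary of \<open>u\<close> stays among its adjacent vertices in \<open>H'\<close>.
  A surviving edge between vertices nonadjacent in \<open>G\<close> thus has escaped this separator,
  which forces \<open>v\<close> to be a proper descendant of \<open>u\<close>.\<close>

lemma skel_rounds_edges:
  assumes G: "lwf_chain_graph G" and ind: "ci_oracle G ind"
    and rounds: "skel_rounds ind (card (verts G) - 1) H sep H' sep'" and inv: "skeleton_inv G H sep"
  shows "skeleton_inv G H' sep'" "edges H' = edges G \<union> (edges G)\<inverse>"
proof -
  note g = is_graph_lwf[OF G]
  show inv': "skeleton_inv G H' sep'"
    using skel_rounds_inv[OF g ind rounds inv] by simp
  have exhausted: "no_separator ind i H' u v" if "(u, v) \<in> edges H'" "i < card (verts G) - 1" for u v i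
    using skel_rounds_inv[OF g ind rounds inv] that by auto
  have le: "edges G \<union> (edges G)\<inverse> \<subseteq> edges H'"
    using skeleton_invD(5)[OF inv'] skeleton_inv_edgeD(4)[OF inv'] by auto
  have desc: "(u, v) \<in> (edges G)\<^sup>* \<and> (v, u) \<notin> (edges G)\<^sup>*"
    if uv: "(u, v) \<in> edges H'" and no: "\<not> adjacent G u v" for u v
  proof (rule ccontr)
    assume *: "\<not> ((u, v) \<in> (edges G)\<^sup>* \<and> (v, u) \<notin> (edges G)\<^sup>*)"
    have V: "u \<in> verts G" "v \<in> verts G" "u \<noteq> v"
      using skeleton_inv_edgeD[OF inv' uv] by auto
    have "c_separates G (bd G {u}) {u} {v}"
      by (rule bd_c_separates[OF G V]) (use * in blast)
    moreover have sub: "bd G {u} \<subseteq> verts G - {u, v}"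
      using g no by (auto simp: bd_singleton[OF g] is_graph_def irrefl_def adjacent_iff)
    ultimately have "ind {u} {v} (bd G {u})"
      using ci_oracleD[OF ind V] by blast
    moreover have "bd G {u} \<subseteq> ad H' u - {v}"
      using sub le unfolding skeleton_inv_ad[OF inv'] bd_singleton[OF g] by auto
    \<comment> \<open>The boundary avoids both \<open>u\<close> and \<open>v\<close>, so its size is
      at most \<open>card (verts G) - 2\<close>, the index of the last round.\<close>
    moreover have "card (bd G {u}) < card (verts G) - 1"
    proof -
      have "card (bd G {u}) \<le> card (verts G - {u, v})"
        using sub g by (intro card_mono) (auto simp: is_graph_def)
      moreover have "card {u, v} \<le> card (verts G)"
        using V g by (intro card_mono) (auto simp: is_graph_def)
      ultimately show ?thesis
        using V by (simp add: card_Diff_subset)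
    qed
    ultimately show False
      using exhausted[OF uv] unfolding no_separator_def by blast
  qed
  have "adjacent G u v" if "(u, v) \<in> edges H'" for u v
  proof -
    have "(v, u) \<in> edges H'"
      by (rule skeleton_inv_edgeD(4)[OF inv' that])
    \<comment> \<open>The edge survives in both orders, but \<open>u\<close> and \<open>v\<close>
      cannot be proper descendants of each other.\<close>
    then show ?thesis
      using desc[OF that] desc[of v u] by (auto simp: adjacent_sym)
  qed
  then show "edges H' = edges G \<union> (edges G)\<inverse>"
    using le by (auto simp: adjacent_iff)
qed

section \<open>Complex recovery\<close>

text \<open>The set \<open>E\<close>, later \<open>edges G\<close>, bounds the current graph from
  below, since orienting removes only pairs outside \<open>E\<close>. This makes the result
  independent of the order in which triples are treated as far as needed.\<close>

lemma fold_orient_step: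
  fixes ts :: "('v \<times> 'v \<times> 'v) list"
  assumes "\<forall>(u, v, w)\<in>set ts. \<not> ind {u} {v} (sep (u, v) \<union> {w}) \<longrightarrow> (u, w) \<in> E \<and> (w, u) \<notin> E"
    and "E \<subseteq> edges H" "H' = fold (orient_step ind sep) ts H"
  shows "verts H' = verts H \<and> E \<subseteq> edges H' \<and> edges H' \<subseteq> edges H \<and>
    (\<forall>(u, v, w)\<in>set ts. \<not> ind {u} {v} (sep (u, v) \<union> {w}) \<longrightarrow> (w, u) \<notin> edges H')"
  using assms
proof (induction ts arbitrary: H)
  case Nil
  then show ?case by simp
next
  case (Cons t ts)
  obtain u v w where t: "t = (u, v, w)"
    by (cases t)
  let ?H1 = "orient_step ind sep t H"
  have "verts ?H1 = verts H" "E \<subseteq> edges ?H1" "edges ?H1 \<subseteq> edges H"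
    using Cons.prems(1,2) by (auto simp: t orient_step_def orient_def)
  \<comment> \<open>If the edge is no longer a line, then \<open>(w, u)\<close> is already gone,
    because \<open>(u, w)\<close> lies in \<open>E\<close>.\<close>
  moreover have "(w, u) \<notin> edges ?H1" if "\<not> ind {u} {v} (sep (u, v) \<union> {w})"
    using Cons.prems(1,2) that by (auto simp: t orient_step_def orient_def line_def)
  moreover have "verts H' = verts ?H1 \<and> E \<subseteq> edges H' \<and> edges H' \<subseteq> edges ?H1 \<and>
    (\<forall>(u, v, w)\<in>set ts. \<not> ind {u} {v} (sep (u, v) \<union> {w}) \<longrightarrow> (w, u) \<notin> edges H')"
    using Cons.prems calculation(2) by (intro Cons.IH) auto
  ultimately show ?case
    unfolding t by auto
qed

text \<open>
  Conditioning on a further \<open>w\<close> destroys c-separation only if \<open>w\<close> enlarges the ancestral set; so \<open>w\<close>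
  is not an ancestor of \<open>u\<close>, and the edge between them points to \<open>w\<close>.
\<close>

lemma orientation_sound:
  assumes g: "is_graph G" and "u \<in> verts G" "v \<in> verts G" "S \<subseteq> verts G" "adjacent G u w"
    and "c_separates G S {u} {v}" "\<not> c_separates G (S \<union> {w}) {u} {v}"
  shows "arrow G u w"
proof -
  have sub: "{u} \<union> {v} \<union> S \<subseteq> verts G"
    using assms by auto
  have "w \<notin> An G ({u} \<union> {v} \<union> S)"
    using c_separates_insert_An[OF g sub] assms(6,7) by blast
  moreover have "u \<in> An G ({u} \<union> {v} \<union> S)"
    using subset_An[of "{u} \<union> {v} \<union> S" G] by auto
  ultimately have "(w, u) \<notin> edges G"
    using An_closed[OF g sub] by blast
  then show ?thesis
    using assms(5) by (auto simp: adjacent_iff arrow_def)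
qed

text \<open>Soundness of each orientation preserves \<open>edges G\<close>. For a complex from
  \<open>a\<close> to \<open>b\<close>, the triple \<open>(a, b, hd vs)\<close> is treated and its
  query fails whichever separator is stored.\<close>

lemma orientation_phase_correct:
  assumes g: "is_graph G" and ind: "ci_oracle G ind" and inv: "skeleton_inv G H sep"
    and H: "edges H = edges G \<union> (edges G)\<inverse>" and phase: "orientation_phase ind H sep H'"
  shows "keeps_complexes G H'"
proof -
  have verts: "verts H = verts G"
    by (rule skeleton_invD(1)[OF inv])
  have adj: "adjacent H x y \<longleftrightarrow> adjacent G x y" "line H x y \<longleftrightarrow> adjacent G x y" for x y
    using H by (auto simp: adjacent_iff line_def)
  let ?ts = "{(u, v, w). u \<in> verts G \<and> v \<in> verts G \<and> u \<noteq> v \<and> \<not> adjacent G u v \<and> adjacent G u w}"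
  obtain ts where ts: "set ts = ?ts" "H' = fold (orient_step ind sep) ts H"
    using phase unfolding orientation_phase_def adj verts by blast
  have sep: "sep (u, v) \<subseteq> verts G - {u, v}" "c_separates G (sep (u, v)) {u} {v}"
    if "u \<in> verts G" "v \<in> verts G" "u \<noteq> v" "\<not> adjacent G u v" for u v
    using skeleton_invD(6)[OF inv that(1-3)] that(4) H unfolding adjacent_iff by auto
  have query: "ind {u} {v} (sep (u, v) \<union> {w}) \<longleftrightarrow> c_separates G (sep (u, v) \<union> {w}) {u} {v}"
    if "(u, v, w) \<in> ?ts" for u v w
  proof (rule ci_oracleD[OF ind])
    show "sep (u, v) \<union> {w} \<subseteq> verts G - {u, v}"
      using that sep(1)[of u v] g by (auto simp: is_graph_def irrefl_def adjacent_iff)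
  qed (use that in auto)
  have "(u, w) \<in> edges G \<and> (w, u) \<notin> edges G"
    if t: "(u, v, w) \<in> ?ts" and "\<not> ind {u} {v} (sep (u, v) \<union> {w})" for u v w
  proof -
    have "arrow G u w"
    proof (rule orientation_sound[OF g])
      show "c_separates G (sep (u, v)) {u} {v}" "sep (u, v) \<subseteq> verts G"
        using t sep[of u v] by auto
      show "\<not> c_separates G (sep (u, v) \<union> {w}) {u} {v}"
        using query[OF t] that(2) by simp
    qed (use t in auto)
    then show ?thesis by (simp add: arrow_def)
  qed
  then have "\<forall>(u, v, w)\<in>set ts. \<not> ind {u} {v} (sep (u, v) \<union> {w}) \<longrightarrow>
      (u, w) \<in> edges G \<and> (w, u) \<notin> edges G"
    unfolding ts(1) by blast
  moreover have "edges G \<subseteq> edges H"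
    using H by simp
  ultimately have res: "verts H' = verts H \<and> edges G \<subseteq> edges H' \<and> edges H' \<subseteq> edges H \<and>
    (\<forall>(u, v, w)\<in>set ts. \<not> ind {u} {v} (sep (u, v) \<union> {w}) \<longrightarrow> (w, u) \<notin> edges H')"
    using ts(2) by (rule fold_orient_step)
  have "(hd vs, a) \<notin> edges H'" if c: "is_minimal_complex G a vs b" for a vs b
  proof -
    note D = is_minimal_complexD[OF c]
    have t: "(a, b, hd vs) \<in> ?ts"
      using D(3,4,5,7,10) by (auto simp: adjacent_def)
    have "\<not> c_separates G (sep (a, b) \<union> {hd vs}) {a} {b}"
      using sep(1)[OF D(4,5,3,10)] by (intro complex_not_c_separates[OF g c]) auto
    then have "\<not> ind {a} {b} (sep (a, b) \<union> {hd vs})"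
      using query[OF t] by simp
    then show ?thesis
      using res t unfolding ts(1) by blast
  qed
  then show ?thesis
    using res verts H unfolding keeps_complexes_def by auto
qed

text \<open>The two outer arrows of a minimal complex label each other: \<open>vs\<close> is still
  an undirected path in \<open>H\<close>, and its inner vertices are adjacent to neither
  end.\<close>

lemma keeps_complexes_pattern:
  assumes keeps: "keeps_complexes G H"
  shows "keeps_complexes G (pattern H)"
  unfolding keeps_complexes_def
proof (intro conjI allI impI)
  note H = verts_F[OF keeps] edges_mono[OF keeps] edges_orient[OF keeps]
  note arrows = kept[OF keeps]
  show "verts (pattern H) = verts G" "edges G \<subseteq> edges (pattern H)"
    "edges (pattern H) \<subseteq> edges G \<union> (edges G)\<inverse>"
    using H by (auto simp: pattern_def arrow_def)
  fix a vs b assume c: "is_minimal_complex G a vs b"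
  note D = is_minimal_complexD[OF c]
  have "arrow H a (hd vs)"
    using D(7) H(2) arrows[OF c] by (auto simp: arrow_def)
  \<comment> \<open>The arrow at \<open>b\<close> is the first arrow of the reversed
    complex.\<close>
  moreover have "arrow H b (last vs)"
    using D(8) H(2) arrows[OF is_minimal_complex_rev[OF c]] by (auto simp: arrow_def hd_rev)
  moreover have "undirected_path H vs"
    using D(1,2,6,9) H(1,2) unfolding undirected_path_def
    by (auto simp: line_def elim!: successively_mono)
  moreover have "adjacent H x y \<longleftrightarrow> adjacent G x y" for x y
    using H(2,3) by (auto simp: adjacent_iff)
  ultimately have "label_pair H (a, hd vs) (b, last vs)"
    using D(3,11) unfolding label_pair_def by auto
  then have "(a, hd vs) \<in> labeled H"
    unfolding labeled_def by blast
  then show "(hd vs, a) \<notin> edges (pattern H)"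
    using arrows[OF c] by (simp add: pattern_def)
qed

theorem lemma5:
  fixes G Hstar :: "'v mgraph"
    and N :: "'v \<Rightarrow> 'a measure"
    and p :: "('v \<Rightarrow> 'a) measure"
    and mb :: "'v \<Rightarrow> 'v set"
  assumes "lwf_chain_graph G"
    and "distribution_over (verts G) N p"
    and "global_markov G N p"
    and "faithful G N p"
    and "\<forall>x\<in>verts G. mb x = Mb G x"
    and "MbLWF (verts G) mb (cond_indep N p) Hstar"
  shows "same_adjacencies G Hstar \<and> minimal_complexes G = minimal_complexes Hstar"
proof -
  note g = is_graph_lwf[OF assms(1)]
  note ind = ci_oracle_cond_indep[OF assms(3,4)]
  obtain sep0 H sep H' where run:
    "blanket_separators (verts G) mb sep0"
    "skel_rounds (cond_indep N p) (card (verts G) - 1) (blanket_graph (verts G) mb) sep0 H sep"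
    "orientation_phase (cond_indep N p) H sep H'" "Hstar = pattern H'"
    using assms(6) unfolding MbLWF_def by blast
  note skel = skel_rounds_edges[OF assms(1) ind run(2) skeleton_inv_blanket[OF g assms(5) run(1)]]
  have keeps: "keeps_complexes G Hstar"
    unfolding run(4)
    by (rule keeps_complexes_pattern[OF orientation_phase_correct[OF g ind skel run(3)]])
  have "same_adjacencies G Hstar"
    using keeps by (auto simp: keeps_complexes_def same_adjacencies_def adjacent_iff)
  moreover have "minimal_complexes G = minimal_complexes Hstar"
    by (rule minimal_complexes_eq[OF keeps])
  ultimately show ?thesis ..
qed

end
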